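(* Suppose $\psi(M_1)\neq 0$. For any $\xi\in\mathbb{C}$, the Whittaker module $L_{\psi,\xi}$ for the Schrödinger-Virasoro algebra $\mathfrak{sv}$ is irreducible.
   Context: The Schrödinger-Virasoro algebra $\mathfrak{sv}$ is the complex Lie algebra with basis $\{L_n,M_n,Y_{n+\frac12}\mid n\in\mathbb{Z}\}$ and brackets, for $m,n\in\mathbb{Z}$: $[L_m,L_n]=(n-m)L_{m+n}$, $[L_m,M_n]=nM_{m+n}$, $[L_m,Y_{n+\frac12}]=(n+\frac{1-m}{2})Y_{m+n+\frac12}$, $[Y_{m+\frac12},Y_{n+\frac12}]=(n-m)M_{m+n+1}$, $[M_m,M_n]=[M_m,Y_{n+\frac12}]=0$. The element $M_0$ is central. Put $\mathfrak{sv}^+=\mathrm{span}_{\mathbb{C}}\{L_n,M_n,Y_{m+\frac12}\mid n\geq 1,\ m\geq 0\}$. Let $\psi:\mathfrak{sv}^+\to\mathbb{C}$ be a Lie algebra homomorphism. A vector $v$ in an $\mathfrak{sv}$-module is a Whittaker vector (of type $\psi$) if $xv=\psi(x)v$ for all $x\in\mathfrak{sv}^+$; an $\mathfrak{sv}$-module is a Whittaker module of type $\psi$ if it is generated by a Whittaker vector of type $\psi$. Write $U(\cdot)$ for the universal enveloping algebra. Let $\mathbb{C}_\psi$ be the one-dimensional $\mathfrak{sv}^+$-module with $x\alpha=\psi(x)\alpha$ for $x\in\mathfrak{sv}^+$, $\alpha\in\mathbb{C}$, let $W_\psi=U(\mathfrak{sv})\otimes_{U(\mathfrak{sv}^+)}\mathbb{C}_\psi$,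 and for $\xi\in\mathbb{C}$ let $L_{\psi,\xi}=W_\psi/(M_0-\xi)W_\psi$. *)

theory Defs
  imports "HOL-Algebra.Algebraic_Closure_Type" "HOL-Library.Poly_Mapping"
begin

section \<open>Complex Lie algebras\<close>

class complex_lie_algebra = ab_group_add +
  fixes scaleC :: "complex \<Rightarrow> 'a \<Rightarrow> 'a" (infixr \<open>*\<^sub>C\<close> 75)
    and lie :: "'a \<Rightarrow> 'a \<Rightarrow> 'a"
  assumes scaleC_add_right: "a *\<^sub>C (x + y) = a *\<^sub>C x + a *\<^sub>C y"
    and scaleC_add_left: "(a + b) *\<^sub>C x = a *\<^sub>C x + b *\<^sub>C x"
    and scaleC_scaleC: "a *\<^sub>C (b *\<^sub>C x) = (a * b) *\<^sub>C x"
    and scaleC_one: "1 *\<^sub>C x = x"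
    and lie_add_left: "lie (x + y) z = lie x z + lie y z"
    and lie_add_right: "lie x (y + z) = lie x y + lie x z"
    and lie_scaleC_left: "lie (a *\<^sub>C x) y = a *\<^sub>C lie x y"
    and lie_scaleC_right: "lie x (a *\<^sub>C y) = a *\<^sub>C lie x y"
    and lie_self: "lie x x = 0"
    and lie_jacobi: "lie x (lie y z) + lie y (lie z x) + lie z (lie x y) = 0"

interpretation complex_vs: vector_space "scaleC :: complex \<Rightarrow> 'a \<Rightarrow> 'a::complex_lie_algebra"
  by unfold_locales (simp_all add: scaleC_add_right scaleC_add_left scaleC_scaleC scaleC_one)

definition lie_hom :: "('a::complex_lie_algebra \<Rightarrow> 'b::complex_lie_algebra) \<Rightarrow> bool" where
  "lie_hom f \<longleftrightarrow>
     (\<forall>x y. f (x + y) = f x + f y) \<and> (\<forall>a x. f (a *\<^sub>C x) = a *\<^sub>C f x) \<and>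
     (\<forall>x y. f (lie x y) = lie (f x) (f y))"

text \<open>The target of \<open>\<psi>\<close>: the one-dimensional abelian Lie algebra.\<close>

instantiation complex :: complex_lie_algebra
begin

definition scaleC_complex :: "complex \<Rightarrow> complex \<Rightarrow> complex" where
  "scaleC_complex a x = a * x"

definition lie_complex :: "complex \<Rightarrow> complex \<Rightarrow> complex" where
  "lie_complex x y = 0"

instance
  by standard (simp_all add: scaleC_complex_def lie_complex_def algebra_simps)

end


section \<open>The universal enveloping algebra\<close>

text \<open>Words over an alphabet under concatenation; wrapping lists makes the convolution product
  of \<^theory>\<open>HOL-Library.Poly_Mapping\<close> the product of the free associative algebra.\<close>

datatype 'a free_monoid = Word (letters: "'a list")

instantiation free_monoid :: (type) monoid_add
begin

definition zero_free_monoid :: "'a free_monoid" where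
  "0 = Word []"

definition plus_free_monoid :: "'a free_monoid \<Rightarrow> 'a free_monoid \<Rightarrow> 'a free_monoid" where
  "v + w = Word (letters v @ letters w)"

instance
  by standard (simp_all add: zero_free_monoid_def plus_free_monoid_def)

end

type_synonym 'a free_algebra = "'a free_monoid \<Rightarrow>\<^sub>0 complex"

definition free_gen :: "'a \<Rightarrow> 'a free_algebra" where
  "free_gen x = Poly_Mapping.single (Word [x]) 1"

definition free_const :: "complex \<Rightarrow> 'a free_algebra" where
  "free_const c = Poly_Mapping.single 0 c"

inductive_set ideal_gen :: "'r::ring_1 set \<Rightarrow> 'r set" for S where
  gen: "x \<in> S \<Longrightarrow> x \<in> ideal_gen S"
| zero: "0 \<in> ideal_gen S"
| add: "x \<in> ideal_gen S \<Longrightarrow> y \<in> ideal_gen S \<Longrightarrow> x + y \<in> ideal_gen S"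
| mult_left: "x \<in> ideal_gen S \<Longrightarrow> r * x \<in> ideal_gen S"
| mult_right: "x \<in> ideal_gen S \<Longrightarrow> x * r \<in> ideal_gen S"

text \<open>All elements of the Lie algebra serve as generators.  The first two families of relations
  turn the free algebra on this set into the tensor algebra of the vector space.\<close>

definition uea_relations :: "'a::complex_lie_algebra free_algebra set" where
  "uea_relations =
     {free_gen (x + y) - free_gen x - free_gen y | x y. True} \<union>
     {free_gen (c *\<^sub>C x) - free_const c * free_gen x | c x. True} \<union>
     {free_gen x * free_gen y - free_gen y * free_gen x - free_gen (lie x y) | x y. True}"

definition uea_eq :: "'a::complex_lie_algebra free_algebra \<Rightarrow> 'a free_algebra \<Rightarrow> bool" where
  "uea_eq p q \<longleftrightarrow> p - q \<in> ideal_gen uea_relations"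

lemma ideal_gen_uminus: "x \<in> ideal_gen S \<Longrightarrow> - x \<in> ideal_gen S"
  using ideal_gen.mult_left[of x S "-1"] by simp

lemma ideal_gen_diff: "x \<in> ideal_gen S \<Longrightarrow> y \<in> ideal_gen S \<Longrightarrow> x - y \<in> ideal_gen S"
  using ideal_gen.add[of x S "- y"] ideal_gen_uminus[of y S] by simp

quotient_type (overloaded) 'a uea = "'a::complex_lie_algebra free_algebra" / uea_eq
proof (rule equivpI)
  show "reflp (uea_eq :: 'a free_algebra \<Rightarrow> _)"
    by (simp add: reflp_def uea_eq_def ideal_gen.zero)
  show "symp (uea_eq :: 'a free_algebra \<Rightarrow> _)"
    unfolding symp_def uea_eq_def by (metis ideal_gen_uminus minus_diff_eq)
  show "transp (uea_eq :: 'a free_algebra \<Rightarrow> _)"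
  proof (rule transpI)
    fix p q r :: "'a free_algebra"
    assume "uea_eq p q" "uea_eq q r"
    then have "(p - q) + (q - r) \<in> ideal_gen uea_relations"
      unfolding uea_eq_def by (rule ideal_gen.add)
    then show "uea_eq p r" by (simp add: uea_eq_def)
  qed
qed

lemma free_monoid_add_eq_0_iff: "v + w = 0 \<longleftrightarrow> v = 0 \<and> w = (0 :: 'a free_monoid)"
  by (cases v; cases w) (simp add: zero_free_monoid_def plus_free_monoid_def)

lemma lookup_mult_0:
  fixes p q :: "'a free_algebra"
  shows "Poly_Mapping.lookup (p * q) 0 = Poly_Mapping.lookup p 0 * Poly_Mapping.lookup q 0"
proof -
  have "Poly_Mapping.lookup (p * q) 0 =
      (\<Sum>l. Poly_Mapping.lookup p l * (\<Sum>m. Poly_Mapping.lookup q m when 0 = l + m))"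
    by (simp add: lookup_mult)
  also have "\<dots> = (\<Sum>l. Poly_Mapping.lookup p l * Poly_Mapping.lookup q 0 when l = 0)"
  proof (rule Sum_any.cong)
    fix l :: "'a free_monoid"
    have "(\<Sum>m. Poly_Mapping.lookup q m when 0 = l + m) =
        (\<Sum>m. (Poly_Mapping.lookup q m when l = 0) when m = 0)"
      by (rule Sum_any.cong) (metis (mono_tags) "when"(1) "when"(2) free_monoid_add_eq_0_iff)
    then show "Poly_Mapping.lookup p l * (\<Sum>m. Poly_Mapping.lookup q m when 0 = l + m) =
        (Poly_Mapping.lookup p l * Poly_Mapping.lookup q 0 when l = 0)"
      by (simp add: when_def)
  qed
  finally show ?thesis by simp
qed

lemma lookup_ideal_0:
  assumes "p \<in> ideal_gen (uea_relations :: 'a::complex_lie_algebra free_algebra set)"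
  shows "Poly_Mapping.lookup p 0 = 0"
  using assms
proof (induction rule: ideal_gen.induct)
  case (gen p)
  have g: "Poly_Mapping.lookup (free_gen z) 0 = 0" for z :: 'a
    by (simp add: free_gen_def zero_free_monoid_def lookup_single_not_eq)
  from gen show ?case
    by (auto simp: uea_relations_def lookup_minus lookup_mult_0 g)
qed (simp_all add: lookup_add lookup_mult_0)

instantiation uea :: (complex_lie_algebra) ring_1
begin

lift_definition zero_uea :: "'a uea" is 0 .

lift_definition one_uea :: "'a uea" is 1 .

lift_definition plus_uea :: "'a uea \<Rightarrow> 'a uea \<Rightarrow> 'a uea" is "(+)"
  unfolding uea_eq_def by (metis add_diff_add ideal_gen.add)

lift_definition uminus_uea :: "'a uea \<Rightarrow> 'a uea" is uminus
  unfolding uea_eq_def by (metis ideal_gen_uminus minus_diff_minus)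

lift_definition minus_uea :: "'a uea \<Rightarrow> 'a uea \<Rightarrow> 'a uea" is "(-)"
  unfolding uea_eq_def
proof -
  fix p p' q q' :: "'a free_algebra"
  assume "p - p' \<in> ideal_gen uea_relations" "q - q' \<in> ideal_gen uea_relations"
  then have "(p - p') - (q - q') \<in> ideal_gen uea_relations"
    by (rule ideal_gen_diff)
  then show "p - q - (p' - q') \<in> ideal_gen uea_relations"
    by (simp add: algebra_simps)
qed

lift_definition times_uea :: "'a uea \<Rightarrow> 'a uea \<Rightarrow> 'a uea" is "(*)"
  unfolding uea_eq_def
proof -
  fix p p' q q' :: "'a free_algebra"
  assume "p - p' \<in> ideal_gen uea_relations" "q - q' \<in> ideal_gen uea_relations"
  then have "(p - p') * q + p' * (q - q') \<in> ideal_gen uea_relations"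
    by (intro ideal_gen.add ideal_gen.mult_left ideal_gen.mult_right)
  then show "p * q - p' * q' \<in> ideal_gen uea_relations"
    by (simp add: algebra_simps)
qed

instance
proof
  show "(0 :: 'a uea) \<noteq> 1"
  proof (transfer, rule notI)
    assume "uea_eq (0 :: 'a free_algebra) 1"
    then have "Poly_Mapping.lookup (0 - 1 :: 'a free_algebra) 0 = 0"
      unfolding uea_eq_def by (rule lookup_ideal_0)
    then show False
      by (simp add: lookup_minus)
  qed
qed (transfer, simp add: uea_eq_def ideal_gen.zero algebra_simps)+

end

lift_definition uea_gen :: "'a::complex_lie_algebra \<Rightarrow> 'a uea" is free_gen .

lift_definition uea_const :: "complex \<Rightarrow> 'a::complex_lie_algebra uea" is free_const .

text \<open>The universal property: \<open>uea_lift s f\<close> is the algebra homomorphism induced by \<open>f\<close>, where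
  \<open>s\<close> is the structure map of the complex algebra \<open>'r\<close>.  It is independent of the
  representative under the assumptions of \<open>uea_lift_abs\<close> below.\<close>

definition free_lift :: "(complex \<Rightarrow> 'r) \<Rightarrow> ('a \<Rightarrow> 'r) \<Rightarrow> 'a free_algebra \<Rightarrow> 'r::ring_1" where
  "free_lift s f p =
     (\<Sum>w\<in>Poly_Mapping.keys p. s (Poly_Mapping.lookup p w) * prod_list (map f (letters w)))"

definition uea_lift ::
    "(complex \<Rightarrow> 'r) \<Rightarrow> ('a \<Rightarrow> 'r) \<Rightarrow> 'a::complex_lie_algebra uea \<Rightarrow> 'r::ring_1" where
  "uea_lift s f u = free_lift s f (rep_uea u)"

lemma free_lift_superset:
  assumes "s 0 = 0" "finite A" "Poly_Mapping.keys p \<subseteq> A"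
  shows "free_lift s f p = (\<Sum>w\<in>A. s (Poly_Mapping.lookup p w) * prod_list (map f (letters w)))"
  unfolding free_lift_def
  by (rule sum.mono_neutral_left) (use assms in \<open>auto simp: in_keys_iff\<close>)

lemma free_lift_single:
  "s 0 = 0 \<Longrightarrow>
    free_lift s f (Poly_Mapping.single w c) = s c * prod_list (map f (letters w))"
  by (subst free_lift_superset[of s "{w}"]) simp_all

lemma free_lift_add:
  assumes s: "s 0 = 0" "\<And>a b. s (a + b) = s a + s b"
  shows "free_lift s f (p + q) = free_lift s f p + free_lift s f q"
proof -
  let ?A = "Poly_Mapping.keys p \<union> Poly_Mapping.keys q"
  have "Poly_Mapping.keys (p + q) \<subseteq> ?A" by (rule keys_add)
  then show ?thesis
    by (simp add: free_lift_superset[where s = s and A = ?A, OF s(1)] lookup_add s(2) distrib_right sum.distrib)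
qed

lemma pm_induct [case_names zero single add]:
  assumes "P 0" and "\<And>a c. P (Poly_Mapping.single a c)" and "\<And>x y. P x \<Longrightarrow> P y \<Longrightarrow> P (x + y)"
  shows "P (x :: 'b \<Rightarrow>\<^sub>0 complex)"
proof -
  have *: "finite A \<Longrightarrow> P (\<Sum>a\<in>A. Poly_Mapping.single a (Poly_Mapping.lookup x a))" for A
    by (induction A rule: finite_induct) (simp_all add: assms)
  have "(\<Sum>a\<in>Poly_Mapping.keys x. Poly_Mapping.single a (Poly_Mapping.lookup x a)) = x"
    by (rule poly_mapping_eqI)
      (simp add: lookup_sum lookup_single when_def in_keys_iff flip: sum.inter_filter)
  with *[of "Poly_Mapping.keys x"] show ?thesis by simp
qed

lemma free_lift_mult:
  fixes s :: "complex \<Rightarrow> 'r::ring_1"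
  assumes s: "s 0 = 0" "\<And>a b. s (a + b) = s a + s b" "\<And>a b. s (a * b) = s a * s b"
    and central: "\<And>c r. s c * r = r * s c"
  shows "free_lift s f (p * q) = free_lift s f p * free_lift s f q"
proof (induction p rule: pm_induct)
  case zero
  show ?case by (simp add: free_lift_def)
next
  case (add p p')
  then show ?case by (simp add: distrib_right free_lift_add[where s = s, OF s(1,2)])
next
  case (single v c)
  show ?case
  proof (induction q rule: pm_induct)
    case zero
    show ?case by (simp add: free_lift_def)
  next
    case (add q q')
    then show ?case by (simp add: distrib_left free_lift_add[where s = s, OF s(1,2)])
  next
    case (single w d)
    have "s c * s d * (V * W) = s c * V * (s d * W)" for V W
      by (metis central mult.assoc)
    then show ?case
      by (simp add: mult_single free_lift_single[where s = s, OF s(1)] plus_free_monoid_def s(3))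
  qed
qed

lemma uea_lift_abs:
  fixes s :: "complex \<Rightarrow> 'r::ring_1" and f :: "'a::complex_lie_algebra \<Rightarrow> 'r"
  assumes s: "\<And>a b. s (a + b) = s a + s b" "\<And>a b. s (a * b) = s a * s b" "s 1 = 1"
    and central: "\<And>c r. s c * r = r * s c"
    and f: "\<And>x y. f (x + y) = f x + f y" "\<And>c x. f (c *\<^sub>C x) = s c * f x"
      "\<And>x y. f (lie x y) = f x * f y - f y * f x"
  shows "uea_lift s f (abs_uea p) = free_lift s f p"
proof -
  have s0: "s 0 = 0" using s(1)[of 0 0] by simp
  note add = free_lift_add[where s = s and f = f, OF s0 s(1)]
  note mult = free_lift_mult[where s = s and f = f, OF s0 s(1,2) central]
  have diff: "free_lift s f (u - v) = free_lift s f u - free_lift s f v" for u v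
    using add[of "u - v" v] by (simp add: algebra_simps)
  have gen: "free_lift s f (free_gen x) = f x" for x
    by (simp add: free_gen_def free_lift_single[where s = s, OF s0] s(3))
  have const: "free_lift s f (free_const c) = s c" for c
    by (simp add: free_const_def free_lift_single[where s = s, OF s0] zero_free_monoid_def)
  have ideal: "free_lift s f u = 0" if "u \<in> ideal_gen uea_relations" for u
    using that
  proof (induction rule: ideal_gen.induct)
    case (gen u)
    then show ?case
      unfolding uea_relations_def
      by (auto simp: diff mult \<open>\<And>x. free_lift s f (free_gen x) = f x\<close> const f)
  qed (simp_all add: add mult free_lift_def[of s f 0])
  have "uea_eq (rep_uea (abs_uea p)) p"
    by (rule Quotient3_rep_abs[OF Quotient3_uea]) (simp add: uea_eq_def ideal_gen.zero)
  then show ?thesis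
    unfolding uea_lift_def uea_eq_def using ideal[of "rep_uea (abs_uea p) - p"] by (simp add: diff)
qed

lemma uea_const_hom:
  "uea_const (a + b) = uea_const a + uea_const b"
  "uea_const (a * b) = uea_const a * uea_const b"
  "uea_const 1 = 1"
  by (transfer, simp add: free_const_def uea_eq_def single_add mult_single ideal_gen.zero)+

lemma free_const_central: "free_const c * p = p * free_const c"
  by (induction p rule: pm_induct) (simp_all add: free_const_def mult_single algebra_simps)

lemma uea_const_central: "uea_const c * u = u * uea_const c"
  by (transfer, simp add: free_const_central uea_eq_def ideal_gen.zero)

lemma uea_gen_hom:
  "uea_gen (x + y) = uea_gen x + uea_gen y"
  "uea_gen (c *\<^sub>C x) = uea_const c * uea_gen x"
  "uea_gen (lie x y) = uea_gen x * uea_gen y - uea_gen y * uea_gen x"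
proof -
  have "uea_eq (free_gen (x + y)) (free_gen x + free_gen y)"
    unfolding uea_eq_def by (rule ideal_gen.gen) (auto simp: uea_relations_def diff_diff_eq)
  then show "uea_gen (x + y) = uea_gen x + uea_gen y" by transfer
  have "uea_eq (free_gen (c *\<^sub>C x)) (free_const c * free_gen x)"
    unfolding uea_eq_def by (rule ideal_gen.gen) (auto simp: uea_relations_def diff_diff_eq)
  then show "uea_gen (c *\<^sub>C x) = uea_const c * uea_gen x" by transfer
  have "uea_eq (free_gen x * free_gen y - free_gen y * free_gen x) (free_gen (lie x y))"
    unfolding uea_eq_def by (rule ideal_gen.gen) (auto simp: uea_relations_def diff_diff_eq)
  then have "uea_gen x * uea_gen y - uea_gen y * uea_gen x = uea_gen (lie x y)" by transfer
  then show "uea_gen (lie x y) = uea_gen x * uea_gen y - uea_gen y * uea_gen x" by simp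
qed


section \<open>Modules\<close>

text \<open>Left modules over a (noncommutative) ring type \<open>'r\<close> are given by the module record;
  its fields \<open>mult\<close> and \<open>one\<close> are meaningless.\<close>

definition quot_module :: "('r, 'v) module \<Rightarrow> 'v set \<Rightarrow> ('r, 'v set) module" where
  "quot_module M N =
     \<lparr>carrier = a_rcosets\<^bsub>M\<^esub> N, monoid.mult = undefined, one = undefined,
      zero = N, add = set_add M,
      module.smult = (\<lambda>r C. \<Union>x\<in>C. N +>\<^bsub>M\<^esub> (r \<odot>\<^bsub>M\<^esub> x))\<rparr>"

text \<open>For a ring homomorphism \<open>\<phi> : R \<rightarrow> S\<close> and a left \<open>R\<close>-module \<open>N\<close> with action \<open>la\<close>, the tensor
  product of \<open>S\<close> and \<open>N\<close> over \<open>R\<close> is the free abelian group on \<open>S \<times> N\<close> modulo the balancing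
  relations, a left \<open>S\<close>-module through the first factor.\<close>

inductive_set tensor_null ::
    "('r \<Rightarrow> 's) \<Rightarrow> ('r \<Rightarrow> 'n \<Rightarrow> 'n) \<Rightarrow> (('s::ring_1 \<times> 'n::ab_group_add) \<Rightarrow>\<^sub>0 int) set"
  for \<phi> la where
  zero: "0 \<in> tensor_null \<phi> la"
| add: "p \<in> tensor_null \<phi> la \<Longrightarrow> q \<in> tensor_null \<phi> la \<Longrightarrow> p + q \<in> tensor_null \<phi> la"
| uminus: "p \<in> tensor_null \<phi> la \<Longrightarrow> - p \<in> tensor_null \<phi> la"
| left: "frag_of (a + b, n) - frag_of (a, n) - frag_of (b, n) \<in> tensor_null \<phi> la"
| right: "frag_of (a, m + n) - frag_of (a, m) - frag_of (a, n) \<in> tensor_null \<phi> la"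
| balanced: "frag_of (a * \<phi> r, n) - frag_of (a, la r n) \<in> tensor_null \<phi> la"

definition free_left_module :: "('s::ring_1, ('s \<times> 'n) \<Rightarrow>\<^sub>0 int) module" where
  "free_left_module =
     \<lparr>carrier = UNIV, monoid.mult = undefined, one = undefined, zero = 0, add = (+),
      module.smult = (\<lambda>s. frag_extend (\<lambda>(a, n). frag_of (s * a, n)))\<rparr>"

definition tensor_module ::
    "('r \<Rightarrow> 's) \<Rightarrow> ('r \<Rightarrow> 'n \<Rightarrow> 'n)
      \<Rightarrow> ('s::ring_1, (('s \<times> 'n::ab_group_add) \<Rightarrow>\<^sub>0 int) set) module" where
  "tensor_module \<phi> la = quot_module free_left_module (tensor_null \<phi> la)"

record ('g, 'v) lie_module = "(complex, 'v) module" +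
  act :: "'g \<Rightarrow> 'v \<Rightarrow> 'v"

locale lie_module =
  module "ring_of_type_algebra :: complex ring" V
  for V :: "('g::complex_lie_algebra, 'v) lie_module" (structure) +
  assumes act_closed: "v \<in> carrier V \<Longrightarrow> act V x v \<in> carrier V"
    and act_add: "v \<in> carrier V \<Longrightarrow> w \<in> carrier V \<Longrightarrow>
      act V x (v \<oplus> w) = act V x v \<oplus> act V x w"
    and act_smult: "v \<in> carrier V \<Longrightarrow> act V x (c \<odot> v) = c \<odot> act V x v"
    and add_act: "v \<in> carrier V \<Longrightarrow> act V (x + y) v = act V x v \<oplus> act V y v"
    and scaleC_act: "v \<in> carrier V \<Longrightarrow> act V (c *\<^sub>C x) v = c \<odot> act V x v"
    and lie_act: "v \<in> carrier V \<Longrightarrow>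
      act V (lie x y) v = act V x (act V y v) \<ominus> act V y (act V x v)"

definition lie_submodule :: "'v set \<Rightarrow> ('g, 'v) lie_module \<Rightarrow> bool" where
  "lie_submodule N V \<longleftrightarrow>
     submodule N (ring_of_type_algebra :: complex ring) V \<and> (\<forall>x. \<forall>v\<in>N. act V x v \<in> N)"

definition irreducible_lie_module :: "('g::complex_lie_algebra, 'v) lie_module \<Rightarrow> bool" where
  "irreducible_lie_module V \<longleftrightarrow>
     lie_module V \<and> carrier V \<noteq> {\<zero>\<^bsub>V\<^esub>} \<and>
     (\<forall>N. lie_submodule N V \<longrightarrow> N = {\<zero>\<^bsub>V\<^esub>} \<or> N = carrier V)"

definition uea_module_to_lie :: "('g::complex_lie_algebra uea, 'v) module \<Rightarrow> ('g, 'v) lie_module" where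
  "uea_module_to_lie M =
     \<lparr>carrier = carrier M, monoid.mult = monoid.mult M, one = one M, zero = zero M, add = add M,
      module.smult = (\<lambda>c v. uea_const c \<odot>\<^bsub>M\<^esub> v), act = (\<lambda>x v. uea_gen x \<odot>\<^bsub>M\<^esub> v)\<rparr>"


section \<open>The Schroedinger-Virasoro algebra\<close>

text \<open>\<open>Y_basis n\<close> stands for the basis element with index \<open>n + 1/2\<close>.\<close>

datatype sv_basis = L_basis int | M_basis int | Y_basis int

fun basis_lie :: "sv_basis \<Rightarrow> sv_basis \<Rightarrow> sv_basis \<Rightarrow>\<^sub>0 complex" where
  "basis_lie (L_basis m) (L_basis n) = Poly_Mapping.single (L_basis (m + n)) (of_int (n - m))"
| "basis_lie (L_basis m) (M_basis n) = Poly_Mapping.single (M_basis (m + n)) (of_int n)"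
| "basis_lie (L_basis m) (Y_basis n) =
     Poly_Mapping.single (Y_basis (m + n)) (of_int n + (1 - of_int m) / 2)"
| "basis_lie (Y_basis m) (Y_basis n) = Poly_Mapping.single (M_basis (m + n + 1)) (of_int (n - m))"
| "basis_lie (M_basis m) (M_basis n) = 0"
| "basis_lie (M_basis m) (Y_basis n) = 0"
| "basis_lie (M_basis n) (L_basis m) = - Poly_Mapping.single (M_basis (m + n)) (of_int n)"
| "basis_lie (Y_basis n) (L_basis m) =
     - Poly_Mapping.single (Y_basis (m + n)) (of_int n + (1 - of_int m) / 2)"
| "basis_lie (Y_basis n) (M_basis m) = 0"

definition pm_scale :: "complex \<Rightarrow> ('b \<Rightarrow>\<^sub>0 complex) \<Rightarrow> 'b \<Rightarrow>\<^sub>0 complex" where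
  "pm_scale c p = Poly_Mapping.map ((*) c) p"

definition bilinear_lie ::
    "(sv_basis \<Rightarrow>\<^sub>0 complex) \<Rightarrow> (sv_basis \<Rightarrow>\<^sub>0 complex) \<Rightarrow> sv_basis \<Rightarrow>\<^sub>0 complex" where
  "bilinear_lie x y = (\<Sum>a\<in>Poly_Mapping.keys x. \<Sum>b\<in>Poly_Mapping.keys y.
     pm_scale (Poly_Mapping.lookup x a * Poly_Mapping.lookup y b) (basis_lie a b))"

typedef sv = "UNIV :: (sv_basis \<Rightarrow>\<^sub>0 complex) set" ..

setup_lifting type_definition_sv

lemma lookup_pm_scale [simp]: "Poly_Mapping.lookup (pm_scale c p) k = c * Poly_Mapping.lookup p k"
  by (simp add: pm_scale_def Poly_Mapping.map.rep_eq when_def)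

lemma pm_scale_add: "pm_scale c (p + q) = pm_scale c p + pm_scale c q"
  by (rule poly_mapping_eqI) (simp add: lookup_add algebra_simps)

lemma pm_scale_add_left: "pm_scale (c + d) p = pm_scale c p + pm_scale d p"
  by (rule poly_mapping_eqI) (simp add: lookup_add algebra_simps)

lemma pm_scale_pm_scale [simp]: "pm_scale c (pm_scale d p) = pm_scale (c * d) p"
  by (rule poly_mapping_eqI) simp

lemma pm_scale_one [simp]: "pm_scale 1 p = p"
  by (rule poly_mapping_eqI) simp

lemma pm_scale_zero_left [simp]: "pm_scale 0 p = 0"
  by (rule poly_mapping_eqI) simp

lemma pm_scale_zero [simp]: "pm_scale c 0 = 0"
  by (rule poly_mapping_eqI) simp

lemma pm_scale_single [simp]:
  "pm_scale c (Poly_Mapping.single k d) = Poly_Mapping.single k (c * d)"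
  by (rule poly_mapping_eqI) (simp add: lookup_single when_def)

lemma pm_scale_sum: "pm_scale c (sum f A) = (\<Sum>a\<in>A. pm_scale c (f a))"
  by (induction A rule: infinite_finite_induct) (simp_all add: pm_scale_add)

lemma bilinear_lie_superset:
  assumes "finite A" "finite B" "Poly_Mapping.keys x \<subseteq> A" "Poly_Mapping.keys y \<subseteq> B"
  shows "bilinear_lie x y = (\<Sum>a\<in>A. \<Sum>b\<in>B.
     pm_scale (Poly_Mapping.lookup x a * Poly_Mapping.lookup y b) (basis_lie a b))"
proof -
  have "bilinear_lie x y = (\<Sum>a\<in>Poly_Mapping.keys x. \<Sum>b\<in>B.
     pm_scale (Poly_Mapping.lookup x a * Poly_Mapping.lookup y b) (basis_lie a b))"
    unfolding bilinear_lie_def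
    by (intro sum.cong refl sum.mono_neutral_left) (use assms in \<open>auto simp: in_keys_iff\<close>)
  also have "\<dots> = (\<Sum>a\<in>A. \<Sum>b\<in>B.
     pm_scale (Poly_Mapping.lookup x a * Poly_Mapping.lookup y b) (basis_lie a b))"
    by (intro sum.mono_neutral_left) (use assms in \<open>auto simp: in_keys_iff\<close>)
  finally show ?thesis .
qed

lemma bilinear_lie_add_left: "bilinear_lie (x + x') y = bilinear_lie x y + bilinear_lie x' y"
proof -
  let ?A = "Poly_Mapping.keys x \<union> Poly_Mapping.keys x'"
  have "Poly_Mapping.keys (x + x') \<subseteq> ?A" by (rule keys_add)
  then show ?thesis
    by (simp add: bilinear_lie_superset[of ?A "Poly_Mapping.keys y"] lookup_add distrib_right
        pm_scale_add_left sum.distrib)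
qed

lemma bilinear_lie_add_right: "bilinear_lie x (y + y') = bilinear_lie x y + bilinear_lie x y'"
proof -
  let ?B = "Poly_Mapping.keys y \<union> Poly_Mapping.keys y'"
  have "Poly_Mapping.keys (y + y') \<subseteq> ?B" by (rule keys_add)
  then show ?thesis
    by (simp add: bilinear_lie_superset[of "Poly_Mapping.keys x" ?B] lookup_add distrib_left
        pm_scale_add_left sum.distrib)
qed

lemma keys_pm_scale: "Poly_Mapping.keys (pm_scale c x) \<subseteq> Poly_Mapping.keys x"
  by (auto simp: in_keys_iff)

lemma bilinear_lie_scale_left: "bilinear_lie (pm_scale c x) y = pm_scale c (bilinear_lie x y)"
  using keys_pm_scale[of c x]
  by (simp add: bilinear_lie_superset[of "Poly_Mapping.keys x" "Poly_Mapping.keys y"]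
      pm_scale_sum mult.assoc)

lemma bilinear_lie_scale_right: "bilinear_lie x (pm_scale c y) = pm_scale c (bilinear_lie x y)"
  using keys_pm_scale[of c y]
  by (simp add: bilinear_lie_superset[of "Poly_Mapping.keys x" "Poly_Mapping.keys y"]
      pm_scale_sum mult_ac)

lemma bilinear_lie_zero [simp]: "bilinear_lie 0 y = 0" "bilinear_lie x 0 = 0"
  by (simp_all add: bilinear_lie_def)

lemma bilinear_lie_single [simp]:
  "bilinear_lie (Poly_Mapping.single a c) (Poly_Mapping.single b d) = pm_scale (c * d) (basis_lie a b)"
  by (simp add: bilinear_lie_superset[of "{a}" "{b}"])

lemma basis_lie_swap: "basis_lie a b = - basis_lie b a"
  by (cases a; cases b) (simp_all add: single_uminus[symmetric] algebra_simps)

lemma pm_scale_uminus: "pm_scale c (- p) = - pm_scale c p"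
  by (rule poly_mapping_eqI) simp

lemma bilinear_lie_swap: "bilinear_lie x y = - bilinear_lie y x"
proof (induction x rule: pm_induct)
  case (single a c)
  show ?case
    by (induction y rule: pm_induct)
      (simp_all add: bilinear_lie_add_left bilinear_lie_add_right basis_lie_swap[of a]
        pm_scale_uminus mult.commute)
qed (simp_all add: bilinear_lie_add_left bilinear_lie_add_right)

lemma bilinear_lie_self: "bilinear_lie x x = 0"
proof (rule poly_mapping_eqI)
  fix k
  have "Poly_Mapping.lookup (bilinear_lie x x) k = - Poly_Mapping.lookup (bilinear_lie x x) k"
    by (metis bilinear_lie_swap lookup_uminus)
  then show "Poly_Mapping.lookup (bilinear_lie x x) k = Poly_Mapping.lookup 0 k"
    by simp
qed

lemma bilinear_lie_jacobi_basis:
  fixes a b c :: sv_basis and p q r :: complex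
  defines "x \<equiv> Poly_Mapping.single a p" and "y \<equiv> Poly_Mapping.single b q"
    and "z \<equiv> Poly_Mapping.single c r"
  shows "bilinear_lie x (bilinear_lie y z) + bilinear_lie y (bilinear_lie z x) +
    bilinear_lie z (bilinear_lie x y) = 0"
  unfolding x_def y_def z_def
  by (rule poly_mapping_eqI, cases a; cases b; cases c)
    (auto simp: lookup_add lookup_single when_def pm_scale_uminus single_uminus[symmetric]
      field_simps)

lemma bilinear_lie_jacobi:
  "bilinear_lie x (bilinear_lie y z) + bilinear_lie y (bilinear_lie z x) +
    bilinear_lie z (bilinear_lie x y) = 0"
proof (induction x rule: pm_induct)
  case (single a p)
  show ?case
  proof (induction y rule: pm_induct)
    case (single b q)
    show ?case
    proof (induction z rule: pm_induct)
      case (single c r)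
      show ?case by (rule bilinear_lie_jacobi_basis)
    next
      case (add z z')
      from arg_cong2[OF this, of "(+)"] show ?case
        by (simp add: bilinear_lie_add_left bilinear_lie_add_right add_ac)
    qed simp
  next
    case (add y y')
    from arg_cong2[OF this, of "(+)"] show ?case
      by (simp add: bilinear_lie_add_left bilinear_lie_add_right add_ac)
  qed simp
next
  case (add x x')
  from arg_cong2[OF this, of "(+)"] show ?case
    by (simp add: bilinear_lie_add_left bilinear_lie_add_right add_ac)
qed simp

instantiation sv :: complex_lie_algebra
begin

lift_definition zero_sv :: sv is 0 .
lift_definition plus_sv :: "sv \<Rightarrow> sv \<Rightarrow> sv" is "(+)" .
lift_definition minus_sv :: "sv \<Rightarrow> sv \<Rightarrow> sv" is "(-)" .
lift_definition uminus_sv :: "sv \<Rightarrow> sv" is uminus .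
lift_definition scaleC_sv :: "complex \<Rightarrow> sv \<Rightarrow> sv" is pm_scale .
lift_definition lie_sv :: "sv \<Rightarrow> sv \<Rightarrow> sv" is bilinear_lie .

instance
  by standard
    (transfer, simp add: add_ac pm_scale_add pm_scale_add_left bilinear_lie_add_left
      bilinear_lie_add_right bilinear_lie_scale_left bilinear_lie_scale_right bilinear_lie_self
      bilinear_lie_jacobi[unfolded add.assoc])+

end

lift_definition sv_L :: "int \<Rightarrow> sv" is "\<lambda>n. Poly_Mapping.single (L_basis n) 1" .
lift_definition sv_M :: "int \<Rightarrow> sv" is "\<lambda>n. Poly_Mapping.single (M_basis n) 1" .
lift_definition sv_Y :: "int \<Rightarrow> sv" is "\<lambda>n. Poly_Mapping.single (Y_basis n) 1" .

lemma sv_brackets: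
  "lie (sv_L m) (sv_L n) = of_int (n - m) *\<^sub>C sv_L (m + n)"
  "lie (sv_L m) (sv_M n) = of_int n *\<^sub>C sv_M (m + n)"
  "lie (sv_L m) (sv_Y n) = (of_int n + (1 - of_int m) / 2) *\<^sub>C sv_Y (m + n)"
  "lie (sv_Y m) (sv_Y n) = of_int (n - m) *\<^sub>C sv_M (m + n + 1)"
  "lie (sv_M m) (sv_M n) = 0"
  "lie (sv_M m) (sv_Y n) = 0"
  by (transfer; simp)+

definition sv_plus_basis :: "sv set" where
  "sv_plus_basis = {sv_L n | n. n \<ge> 1} \<union> {sv_M n | n. n \<ge> 1} \<union> {sv_Y m | m. m \<ge> 0}"

lemma lie_swap: "lie x y = - lie y (x :: 'a::complex_lie_algebra)"
proof -
  have "lie (x + y) (x + y) = lie x x + lie x y + (lie y x + lie y y)"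
    by (simp only: lie_add_left lie_add_right add_ac)
  then have "lie x y + lie y x = 0" by (simp only: lie_self) simp
  then show ?thesis by (simp add: eq_neg_iff_add_eq_0)
qed

lemma lie_zero [simp]: "lie 0 x = 0" "lie x 0 = (0 :: 'a::complex_lie_algebra)"
  using lie_add_left[of 0 0 x] lie_add_right[of x 0 0] by simp_all

lemma lie_sv_plus_basis:
  assumes "x \<in> sv_plus_basis" "y \<in> sv_plus_basis"
  shows "lie x y \<in> complex_vs.span sv_plus_basis"
proof -
  have L: "sv_L n \<in> complex_vs.span sv_plus_basis" if "n \<ge> 1" for n
    by (rule complex_vs.span_base) (use that in \<open>auto simp: sv_plus_basis_def\<close>)
  have M: "sv_M n \<in> complex_vs.span sv_plus_basis" if "n \<ge> 1" for n
    by (rule complex_vs.span_base) (use that in \<open>auto simp: sv_plus_basis_def\<close>)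
  have Y: "sv_Y n \<in> complex_vs.span sv_plus_basis" if "n \<ge> 0" for n
    by (rule complex_vs.span_base) (use that in \<open>auto simp: sv_plus_basis_def\<close>)
  have LL: "lie (sv_L m) (sv_L n) \<in> complex_vs.span sv_plus_basis" if "m \<ge> 1" "n \<ge> 1" for m n
    unfolding sv_brackets by (intro complex_vs.span_scale L) (use that in simp)
  have LM: "lie (sv_L m) (sv_M n) \<in> complex_vs.span sv_plus_basis" if "m \<ge> 1" "n \<ge> 1" for m n
    unfolding sv_brackets by (intro complex_vs.span_scale M) (use that in simp)
  have LY: "lie (sv_L m) (sv_Y n) \<in> complex_vs.span sv_plus_basis" if "m \<ge> 1" "n \<ge> 0" for m n
    unfolding sv_brackets by (intro complex_vs.span_scale Y) (use that in simp)
  have YY: "lie (sv_Y m) (sv_Y n) \<in> complex_vs.span sv_plus_basis" if "m \<ge> 0" "n \<ge> 0" for m n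
    unfolding sv_brackets by (intro complex_vs.span_scale M) (use that in simp)
  have MM: "lie (sv_M m) (sv_M n) \<in> complex_vs.span sv_plus_basis" for m n
    unfolding sv_brackets by (rule complex_vs.span_zero)
  have MY: "lie (sv_M m) (sv_Y n) \<in> complex_vs.span sv_plus_basis" for m n
    unfolding sv_brackets by (rule complex_vs.span_zero)
  have swap: "lie v w \<in> complex_vs.span sv_plus_basis"
    if "lie w v \<in> complex_vs.span sv_plus_basis" for v w
    using complex_vs.span_neg[OF that] lie_swap[of v w] by simp
  from assms consider
    m n where "x = sv_L m" "y = sv_L n" "m \<ge> 1" "n \<ge> 1"
  | m n where "x = sv_L m" "y = sv_M n" "m \<ge> 1" "n \<ge> 1"
  | m n where "x = sv_M n" "y = sv_L m" "m \<ge> 1" "n \<ge> 1"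
  | m n where "x = sv_L m" "y = sv_Y n" "m \<ge> 1" "n \<ge> 0"
  | m n where "x = sv_Y n" "y = sv_L m" "m \<ge> 1" "n \<ge> 0"
  | m n where "x = sv_Y m" "y = sv_Y n" "m \<ge> 0" "n \<ge> 0"
  | m n where "x = sv_M m" "y = sv_M n"
  | m n where "x = sv_M m" "y = sv_Y n"
  | m n where "x = sv_Y n" "y = sv_M m"
    unfolding sv_plus_basis_def by blast
  then show ?thesis
    by cases (blast intro: LL LM LY YY MM MY swap)+
qed

lemma lie_span_sv_plus:
  assumes "x \<in> complex_vs.span sv_plus_basis" "y \<in> complex_vs.span sv_plus_basis"
  shows "lie x y \<in> complex_vs.span sv_plus_basis"
proof -
  have *: "lie a y \<in> complex_vs.span sv_plus_basis" if "a \<in> sv_plus_basis" for a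
    using assms(2)
  proof (induction rule: complex_vs.span_induct_alt)
    case (step c b z)
    then show ?case
      by (simp add: lie_add_right lie_scaleC_right complex_vs.span_add complex_vs.span_scale
          lie_sv_plus_basis that)
  qed (simp add: complex_vs.span_zero)
  from assms(1) show ?thesis
  proof (induction rule: complex_vs.span_induct_alt)
    case (step c b z)
    then show ?case
      by (simp add: lie_add_left lie_scaleC_left complex_vs.span_add complex_vs.span_scale *)
  qed (simp add: complex_vs.span_zero)
qed

typedef sv_plus = "complex_vs.span sv_plus_basis"
  by (rule exI, rule complex_vs.span_zero)

setup_lifting type_definition_sv_plus

instantiation sv_plus :: complex_lie_algebra
begin

lift_definition zero_sv_plus :: sv_plus is 0 by (rule complex_vs.span_zero)
lift_definition plus_sv_plus :: "sv_plus \<Rightarrow> sv_plus \<Rightarrow> sv_plus" is "(+)"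
  by (rule complex_vs.span_add)
lift_definition minus_sv_plus :: "sv_plus \<Rightarrow> sv_plus \<Rightarrow> sv_plus" is "(-)"
  by (rule complex_vs.span_diff)
lift_definition uminus_sv_plus :: "sv_plus \<Rightarrow> sv_plus" is uminus
  by (rule complex_vs.span_neg)
lift_definition scaleC_sv_plus :: "complex \<Rightarrow> sv_plus \<Rightarrow> sv_plus" is scaleC
  by (rule complex_vs.span_scale)
lift_definition lie_sv_plus :: "sv_plus \<Rightarrow> sv_plus \<Rightarrow> sv_plus" is lie
  by (rule lie_span_sv_plus)

instance
  by standard
    (transfer, simp add: add_ac scaleC_add_left scaleC_add_right scaleC_scaleC scaleC_one
      lie_add_left lie_add_right lie_scaleC_left lie_scaleC_right lie_self
      lie_jacobi[unfolded add.assoc])+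

end

lift_definition sv_plus_M1 :: sv_plus is "sv_M 1"
  by (rule complex_vs.span_base) (auto simp: sv_plus_basis_def)


section \<open>Whittaker modules\<close>

definition sv_plus_uea_incl :: "sv_plus uea \<Rightarrow> sv uea" where
  "sv_plus_uea_incl = uea_lift uea_const (\<lambda>x. uea_gen (Rep_sv_plus x))"

lemma sv_plus_uea_incl_abs:
  "sv_plus_uea_incl (abs_uea p) = free_lift uea_const (\<lambda>x. uea_gen (Rep_sv_plus x)) p"
  unfolding sv_plus_uea_incl_def
  by (rule uea_lift_abs; (rule uea_const_central)?)
    (simp_all add: uea_const_hom uea_gen_hom plus_sv_plus.rep_eq lie_sv_plus.rep_eq
      scaleC_sv_plus.rep_eq)

lemma uea_lift_lie_hom_abs:
  "lie_hom \<psi> \<Longrightarrow> uea_lift (\<lambda>c. c) \<psi> (abs_uea p) = free_lift (\<lambda>c. c) \<psi> p"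
  by (rule uea_lift_abs) (auto simp: lie_hom_def scaleC_complex_def lie_complex_def)

lemma sv_plus_uea_incl_gen: "sv_plus_uea_incl (uea_gen x) = uea_gen (Rep_sv_plus x)"
  unfolding uea_gen.abs_eq[of x] sv_plus_uea_incl_abs
proof -
  have z: "uea_const 0 = (0 :: sv uea)"
    by (transfer, simp add: free_const_def uea_eq_def ideal_gen.zero)
  show "free_lift uea_const (\<lambda>x. uea_gen (Rep_sv_plus x)) (free_gen x) = uea_gen (Rep_sv_plus x)"
    by (simp add: free_gen_def free_lift_single[where s = uea_const, OF z] uea_const_hom)
qed

text \<open>The action on \<open>\<complex>\<^sub>\<psi>\<close>, extended from \<open>sv_plus\<close> to its enveloping algebra.\<close>

definition one_dim_action :: "(sv_plus \<Rightarrow> complex) \<Rightarrow> sv_plus uea \<Rightarrow> complex \<Rightarrow> complex" where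
  "one_dim_action \<psi> u \<alpha> = uea_lift (\<lambda>c. c) \<psi> u * \<alpha>"

definition whittaker_W ::
    "(sv_plus \<Rightarrow> complex) \<Rightarrow> (sv uea, ((sv uea \<times> complex) \<Rightarrow>\<^sub>0 int) set) module" where
  "whittaker_W \<psi> = tensor_module sv_plus_uea_incl (one_dim_action \<psi>)"

definition whittaker_L ::
    "(sv_plus \<Rightarrow> complex) \<Rightarrow> complex
      \<Rightarrow> (sv uea, ((sv uea \<times> complex) \<Rightarrow>\<^sub>0 int) set set) module" where
  "whittaker_L \<psi> \<xi> = quot_module (whittaker_W \<psi>)
     {(uea_gen (sv_M 0) - uea_const \<xi>) \<odot>\<^bsub>whittaker_W \<psi>\<^esub> w | w. w \<in> carrier (whittaker_W \<psi>)}"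

end

theory Submission
  imports Defs
begin

text \<open>
  Write \<open>U\<close> for the enveloping algebra of \<open>sv\<close>, let \<open>v\<close> be the generator of \<open>L\<close>, and let \<open>\<phi>\<close> be the
  extension of \<open>\<psi>\<close> to the subalgebra \<open>sv\<^sup>+ + \<complex> M\<^sub>0\<close> by \<open>\<phi>(M\<^sub>0) = \<xi>\<close>.  The annihilator \<open>I\<close> of \<open>v\<close> is a
  left ideal that contains \<open>z - \<phi>(z)\<close> for every basis element \<open>z\<close> of this subalgebra, and \<open>U v\<close> is
  all of \<open>L\<close>, so submodules of \<open>L\<close> correspond to left ideals above \<open>I\<close>.  Irreducibility says that
  \<open>1 \<notin> I\<close> and that every left ideal \<open>J \<supseteq> I\<close> without \<open>1\<close> equals \<open>I\<close>.

  For the second part, \<open>U\<close> is spanned modulo \<open>I\<close> by words in the remaining (negative) basis elements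
  \<open>L\<^bsub>-k\<^esub>\<close> with \<open>k \<ge> 0\<close>, \<open>M\<^bsub>-k\<^esub>\<close> and \<open>Y\<^bsub>-k + 1/2\<^esub>\<close> with \<open>k \<ge> 1\<close>.  These get positive weights for which
  each commutator lowers the weight by four.  Every negative letter \<open>x\<close> has a
  dual letter \<open>x'\<close> in the subalgebra with \<open>[x', x]\<close> a nonzero multiple of \<open>M\<^sub>1\<close>, and among the letters
  on which \<open>\<phi>\<close> can be nonzero, \<open>M\<^sub>1\<close> has the strictly smallest weight.  As \<open>\<psi>(M\<^sub>1) \<noteq> 0\<close>, the
  operator \<open>x' - \<phi>(x')\<close> acts on words, up to terms of lower weight, as a nonzero multiple of the partial derivative by \<open>x\<close>
  (\<open>lowering_word\<close>).  Hence \<open>\<Sum>\<^sub>x x \<partial>\<^sub>x\<close> multiplies a word by its length, up to lower weight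
  (\<open>euler_word\<close>).  Suitable multiples \<open>\<partial>\<^sub>x\<close> of \<open>x' - \<phi>(x')\<close> preserve \<open>J\<close> and lower the weight, so
  \<open>\<partial>\<^sub>x u \<in> I\<close> for \<open>u \<in> J\<close> by induction on the weight; then the Euler operator sends \<open>u\<close> into \<open>I\<close>, and
  an inner induction on the length gives \<open>u \<in> I\<close> (\<open>maximal\<close>).

  For the first part one needs a linear functional on \<open>U\<close> with value 1 at 1 for which each \<open>z\<close> in the
  subalgebra acts from the right by \<open>\<phi>(z)\<close> (\<open>uea_functional_exists\<close>).  It is the piece of the
  Poincare-Birkhoff-Witt theorem that the nontriviality of an induced module amounts to, and it is
  obtained by straightening words in the basis, where confluence is the Jacobi identity
  (\<open>resolutions_agree\<close>).
\<close>

section \<open>Structure constants\<close>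

text \<open>The bracket of two basis elements is always a multiple of a single basis element.  The last equation
  is a dummy index for brackets that vanish identically.\<close>

fun bracket_index :: "sv_basis \<Rightarrow> sv_basis \<Rightarrow> sv_basis" where
  "bracket_index (L_basis m) (L_basis n) = L_basis (m + n)"
| "bracket_index (L_basis m) (M_basis n) = M_basis (m + n)"
| "bracket_index (L_basis m) (Y_basis n) = Y_basis (m + n)"
| "bracket_index (M_basis m) (L_basis n) = M_basis (m + n)"
| "bracket_index (Y_basis m) (L_basis n) = Y_basis (m + n)"
| "bracket_index (Y_basis m) (Y_basis n) = M_basis (m + n + 1)"
| "bracket_index _ _ = M_basis 0"

fun bracket_coeff :: "sv_basis \<Rightarrow> sv_basis \<Rightarrow> complex" where
  "bracket_coeff (L_basis m) (L_basis n) = of_int (n - m)"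
| "bracket_coeff (L_basis m) (M_basis n) = of_int n"
| "bracket_coeff (L_basis m) (Y_basis n) = of_int n + (1 - of_int m) / 2"
| "bracket_coeff (M_basis m) (L_basis n) = - of_int m"
| "bracket_coeff (Y_basis m) (L_basis n) = - (of_int m + (1 - of_int n) / 2)"
| "bracket_coeff (Y_basis m) (Y_basis n) = of_int (n - m)"
| "bracket_coeff _ _ = 0"

lift_definition sv_base :: "sv_basis \<Rightarrow> sv" is "\<lambda>b. Poly_Mapping.single b 1" .

lemma basis_lie_bracket:
  "basis_lie a b = Poly_Mapping.single (bracket_index a b) (bracket_coeff a b)"
  by (cases a; cases b) (simp_all add: single_uminus[symmetric] add.commute)

lemma lie_sv_base:
  "lie (sv_base a) (sv_base b) = bracket_coeff a b *\<^sub>C sv_base (bracket_index a b)"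
  by transfer (simp add: basis_lie_bracket)

lemma bracket_index_commute: "bracket_index a b = bracket_index b a"
  by (cases a; cases b) simp_all

lemma bracket_coeff_swap: "bracket_coeff a b = - bracket_coeff b a"
  by (cases a; cases b) simp_all

text \<open>The three nested indices agree unless a coefficient vanishes, so the identity is stated under an
  arbitrary function of the index instead of with a common one.\<close>

lemma bracket_coeff_jacobi:
  fixes f :: "sv_basis \<Rightarrow> complex"
  shows "bracket_coeff x y * (bracket_coeff (bracket_index x y) z * f (bracket_index (bracket_index x y) z))
    + bracket_coeff y z * (bracket_coeff (bracket_index y z) x * f (bracket_index (bracket_index y z) x))
    + bracket_coeff z x * (bracket_coeff (bracket_index z x) y * f (bracket_index (bracket_index z x) y)) = 0"
  by (cases x; cases y; cases z; simp add: add_ac;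
    simp add: ring_distribs add_divide_distrib diff_divide_distrib)

text \<open>An order of the basis in which the elements of \<open>sv\<^sup>+\<close> and \<open>M\<^sub>0\<close> are exactly those of rank at least 0:
  ordered words then have their letters from the subalgebra on the right.\<close>

fun basis_rank :: "sv_basis \<Rightarrow> int" where
  "basis_rank (L_basis n) = 3 * (n - 1)"
| "basis_rank (M_basis n) = 3 * n + 1"
| "basis_rank (Y_basis n) = 3 * n + 2"

lemma basis_rank_inj: "basis_rank a = basis_rank b \<longleftrightarrow> a = b"
  by (cases a; cases b) (auto, presburger+)

section \<open>Straightening words\<close>

text \<open>The function \<open>\<chi>\<close> prescribes values on ordered words; it extends to all words so that swapping two adjacent
  letters costs the term with their bracket.  This is the existence half of the
  Poincare-Birkhoff-Witt theorem, for structure constants as above.\<close>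

locale straightening =
  fixes rank :: "'b \<Rightarrow> int" and br :: "'b \<Rightarrow> 'b \<Rightarrow> 'b" and co :: "'b \<Rightarrow> 'b \<Rightarrow> complex"
    and \<chi> :: "'b list \<Rightarrow> complex"
  assumes rank_inj: "rank x = rank y \<Longrightarrow> x = y"
    and br_commute: "br x y = br y x"
    and co_swap: "co x y = - co y x"
    and jacobi: "co x y * (co (br x y) z * f (br (br x y) z))
      + co y z * (co (br y z) x * f (br (br y z) x))
      + co z x * (co (br z x) y * f (br (br z x) y)) = 0"
begin

lemma co_self: "co x x = 0"
  using co_swap[of x x] by simp

fun inversions :: "'b list \<Rightarrow> nat" where
  "inversions [] = 0"
| "inversions (x # w) = length (filter (\<lambda>y. rank y < rank x) w) + inversions w"

lemma inversions_swap:
  "rank y < rank x \<Longrightarrow> inversions (u @ x # y # v) = Suc (inversions (u @ y # x # v))"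
  by (induction u) simp_all

abbreviation ordered :: "'b list \<Rightarrow> bool" where
  "ordered w \<equiv> sorted (map rank w)"

lemma not_ordered_descent:
  "\<not> ordered w \<Longrightarrow> \<exists>u x y v. w = u @ x # y # v \<and> rank y < rank x"
proof (induction w)
  case (Cons a w)
  show ?case
  proof (cases "ordered w")
    case True
    with Cons.prems obtain b w' where "w = b # w'" "rank b < rank a"
      by (cases w) auto
    then have "a # w = [] @ a # b # w' \<and> rank b < rank a" by simp
    then show ?thesis by blast
  next
    case False
    with Cons.IH obtain u x y v where "w = u @ x # y # v" "rank y < rank x" by blast
    then have "a # w = (a # u) @ x # y # v \<and> rank y < rank x" by simp
    then show ?thesis by blast
  qed
qed simp

definition descent :: "'b list \<Rightarrow> 'b list \<times> 'b \<times> 'b \<times> 'b list" where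
  "descent w = (SOME (u, x, y, v). w = u @ x # y # v \<and> rank y < rank x)"

lemma descentD:
  assumes "\<not> ordered w" "descent w = (u, x, y, v)"
  shows "w = u @ x # y # v \<and> rank y < rank x"
proof -
  have "\<exists>t. case t of (u, x, y, v) \<Rightarrow> w = u @ x # y # v \<and> rank y < rank x"
    using not_ordered_descent[OF assms(1)] by auto
  from someI_ex[OF this] show ?thesis
    using assms(2) by (simp add: descent_def)
qed

text \<open>Resolving a descent yields a word of equal length with one inversion less, and a shorter word.\<close>

definition smaller :: "('b list \<times> 'b list) set" where
  "smaller = inv_image (less_than <*lex*> less_than) (\<lambda>w. (length w, inversions w))"

lemma wf_smaller: "wf smaller"
  unfolding smaller_def by (intro wf_inv_image wf_lex_prod wf_less_than)

lemma smaller_intros: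
  "length w < length w' \<Longrightarrow> (w, w') \<in> smaller"
  "rank y < rank x \<Longrightarrow> (u @ y # x # v, u @ x # y # v) \<in> smaller"
  by (auto simp: smaller_def inversions_swap)

text \<open>The descent to resolve is chosen arbitrarily; \<open>straight_descent\<close> shows that any other choice
  gives the same value.\<close>

function straight :: "'b list \<Rightarrow> complex" where
  "straight w = (if ordered w then \<chi> w else
     (case descent w of (u, x, y, v) \<Rightarrow>
        straight (u @ y # x # v) + co x y * straight (u @ br x y # v)))"
  by pat_completeness auto
termination
proof (relation smaller)
  show "wf smaller" by (rule wf_smaller)
qed (metis descentD smaller_intros(2),
     metis descentD smaller_intros(1) length_append length_Cons add_Suc_right lessI)

declare straight.simps [simp del]

lemma straight_ordered: "ordered w \<Longrightarrow> straight w = \<chi> w"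
  by (simp add: straight.simps[of w])

text \<open>Disjoint descents can be resolved in either order.  For overlapping descents \<open>x y z\<close>, completing both
  resolutions down to \<open>z y x\<close> leaves a difference that is the Jacobi expression evaluated on words
  with two letters fewer.\<close>

lemma resolutions_agree:
  assumes IH: "\<And>u x y v. (u @ x # y # v, w) \<in> smaller \<Longrightarrow> rank y < rank x \<Longrightarrow>
      straight (u @ x # y # v) = straight (u @ y # x # v) + co x y * straight (u @ br x y # v)"
    and w: "w = u @ x # y # v" "rank y < rank x"
    and w': "w = u' @ x' # y' # v'" "rank y' < rank x'"
    and le: "length u \<le> length u'"
  shows "straight (u @ y # x # v) + co x y * straight (u @ br x y # v)
       = straight (u' @ y' # x' # v') + co x' y' * straight (u' @ br x' y' # v')"
proof -
  obtain m where m: "u' = u @ m" "x # y # v = m @ x' # y' # v'"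
    using w(1) w'(1) le by (auto simp: append_eq_append_conv2)
  have IH1: "straight (p @ a # b # q) = straight (p @ b # a # q) + co a b * straight (p @ br a b # q)"
    if "length (p @ a # b # q) < length w" for p a b q
  proof (cases "rank a" "rank b" rule: linorder_cases)
    case greater
    then show ?thesis using IH smaller_intros(1)[OF that] by blast
  next
    case equal
    then have "a = b" by (rule rank_inj)
    then show ?thesis by (simp add: co_self)
  next
    case less
    have "length (p @ b # a # q) < length w" using that by simp
    from IH[OF smaller_intros(1)[OF this] less] show ?thesis
      by (simp add: co_swap[of b a] br_commute[of b a])
  qed
  consider "m = []" | "m = [x]" | k where "m = x # y # k"
    using m(2) by (metis (no_types, opaque_lifting) append_Cons list.inject neq_Nil_conv)
  then show ?thesis
  proof cases
    case 1
    with m show ?thesis by simp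
  next
    case 2
    let ?z = y'
    from 2 m have eq: "x' = y" "v = ?z # v'" "u' = u @ [x]" by auto
    have lt: "rank ?z < rank y" using w'(2) eq by simp
    have trans: "rank ?z < rank x" using lt w(2) by simp
    have w3: "w = u @ x # y # ?z # v'" using w(1) eq by simp
    have s1: "(u @ y # x # ?z # v', w) \<in> smaller"
      using smaller_intros(2)[OF w(2), of u "?z # v'"] w3 by simp
    have s2: "(u @ x # ?z # y # v', w) \<in> smaller"
      using smaller_intros(2)[OF lt, of "u @ [x]" v'] w3 by simp
    have tr: "trans smaller"
      unfolding smaller_def by (intro trans_inv_image trans_lex_prod trans_less_than)
    have s3: "(u @ y # ?z # x # v', w) \<in> smaller"
      using smaller_intros(2)[OF trans, of "u @ [y]" v'] s1 transD[OF tr] by simp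
    have s4: "(u @ ?z # x # y # v', w) \<in> smaller"
      using smaller_intros(2)[OF trans, of "u" "y # v'"] s2 transD[OF tr] by simp
    have e1: "straight (u @ y # x # ?z # v') =
        straight (u @ y # ?z # x # v') + co x ?z * straight (u @ y # br x ?z # v')"
      using trans IH[of "u @ [y]" x ?z v'] s1 by simp
    have e2: "straight (u @ y # ?z # x # v') =
        straight (u @ ?z # y # x # v') + co y ?z * straight (u @ br y ?z # x # v')"
      using lt IH[of u y ?z "x # v'"] s3 by simp
    have e3: "straight (u @ x # ?z # y # v') =
        straight (u @ ?z # x # y # v') + co x ?z * straight (u @ br x ?z # y # v')"
      using trans IH[of u x ?z "y # v'"] s2 by simp
    have e4: "straight (u @ ?z # x # y # v') =
        straight (u @ ?z # y # x # v') + co x y * straight (u @ ?z # br x y # v')"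
      using w(2) IH[of "u @ [?z]" x y v'] s4 by simp
    have f1: "straight (u @ br x y # ?z # v') = straight (u @ ?z # br x y # v')
        + co (br x y) ?z * straight (u @ br (br x y) ?z # v')"
      by (rule IH1) (simp add: w3)
    have f2: "straight (u @ br y ?z # x # v') = straight (u @ x # br y ?z # v')
        + co (br y ?z) x * straight (u @ br (br y ?z) x # v')"
      by (rule IH1) (simp add: w3)
    have f3: "straight (u @ br x ?z # y # v') = straight (u @ y # br x ?z # v')
        + co (br ?z x) y * straight (u @ br (br ?z x) y # v')"
      unfolding br_commute[of ?z x] by (rule IH1) (simp add: w3)
    have jac: "co x y * (co (br x y) ?z * straight (u @ br (br x y) ?z # v'))
      + co y ?z * (co (br y ?z) x * straight (u @ br (br y ?z) x # v'))
      + co ?z x * (co (br ?z x) y * straight (u @ br (br ?z x) y # v')) = 0"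
      using jacobi[of x y ?z "\<lambda>b. straight (u @ b # v')"] .
    have "straight (u @ y # x # v) + co x y * straight (u @ br x y # v) -
        (straight (u' @ y' # x' # v') + co x' y' * straight (u' @ br x' y' # v')) =
        co x y * (co (br x y) ?z * straight (u @ br (br x y) ?z # v'))
      + co y ?z * (co (br y ?z) x * straight (u @ br (br y ?z) x # v'))
      + co ?z x * (co (br ?z x) y * straight (u @ br (br ?z x) y # v'))"
      unfolding eq append_assoc append_Cons append_Nil e1 e2 e3 e4 f1 f2 f3 co_swap[of ?z x]
      by (simp add: algebra_simps)
    with jac show ?thesis by simp
  next
    case (3 k)
    from 3 m have eq: "v = k @ x' # y' # v'" "u' = u @ x # y # k" by auto
    have "(u @ y # x # k @ x' # y' # v', w) \<in> smaller"
      using smaller_intros(2)[OF w(2), of u v] w(1) eq by simp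
    with w'(2) have e1: "straight (u @ y # x # k @ x' # y' # v') = straight (u @ y # x # k @ y' # x' # v')
        + co x' y' * straight (u @ y # x # k @ br x' y' # v')"
      using IH[of "u @ y # x # k" x' y' v'] by simp
    have "(u @ x # y # k @ y' # x' # v', w) \<in> smaller"
      using smaller_intros(2)[OF w'(2), of u' v'] w'(1) eq by simp
    with w(2) have e2: "straight (u @ x # y # k @ y' # x' # v') = straight (u @ y # x # k @ y' # x' # v')
        + co x y * straight (u @ br x y # k @ y' # x' # v')"
      using IH[of u x y "k @ y' # x' # v'"] by simp
    have e3: "straight (u @ br x y # k @ x' # y' # v') = straight (u @ br x y # k @ y' # x' # v')
        + co x' y' * straight (u @ br x y # k @ br x' y' # v')"
      using IH1[of "u @ br x y # k" x' y' v'] w(1) eq by simp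
    have e4: "straight (u @ x # y # k @ br x' y' # v') = straight (u @ y # x # k @ br x' y' # v')
        + co x y * straight (u @ br x y # k @ br x' y' # v')"
      using IH1[of u x y "k @ br x' y' # v'"] w(1) eq by simp
    show ?thesis
      unfolding eq append_assoc append_Cons e1 e2 e3 e4 by (simp add: algebra_simps)
  qed
qed

lemma straight_descent:
  assumes "rank y < rank x"
  shows "straight (u @ x # y # v) = straight (u @ y # x # v) + co x y * straight (u @ br x y # v)"
  using assms
proof (induction "u @ x # y # v" arbitrary: u x y v rule: wf_induct_rule[OF wf_smaller])
  case (1 u x y v)
  let ?w = "u @ x # y # v"
  note rel = 1(1)
  have "\<not> ordered ?w" using 1(2) by (auto simp: sorted_append)
  obtain u' x' y' v' where d: "descent ?w = (u', x', y', v')" by (metis prod_cases4)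
  note D = descentD[OF \<open>\<not> ordered ?w\<close> d]
  have "straight ?w = straight (u' @ y' # x' # v') + co x' y' * straight (u' @ br x' y' # v')"
    using \<open>\<not> ordered ?w\<close> d by (simp add: straight.simps[of ?w])
  also have "\<dots> = straight (u @ y # x # v) + co x y * straight (u @ br x y # v)"
    using resolutions_agree[OF rel, of ?w u x y v u' x' y' v']
      resolutions_agree[OF rel, of ?w u' x' y' v' u x y v] D 1(2) by (metis nat_le_linear)
  finally show ?case .
qed

end

text \<open>The letters of nonnegative rank span a subalgebra with character \<open>\<phi>\<close>.  Among ordered words only those
  from the subalgebra get a nonzero value, which models the component along the generator of the module
  induced from \<open>\<phi>\<close>.\<close>

locale induced_character =
  straightening rank br co "\<lambda>w. if \<forall>z\<in>set w. 0 \<le> rank z then prod_list (map \<phi> w) else 0"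
  for rank :: "'b \<Rightarrow> int" and br :: "'b \<Rightarrow> 'b \<Rightarrow> 'b" and co :: "'b \<Rightarrow> 'b \<Rightarrow> complex"
    and \<phi> :: "'b \<Rightarrow> complex" +
  assumes br_closed: "0 \<le> rank x \<Longrightarrow> 0 \<le> rank y \<Longrightarrow> co x y \<noteq> 0 \<Longrightarrow> 0 \<le> rank (br x y)"
    and \<phi>_bracket: "0 \<le> rank x \<Longrightarrow> 0 \<le> rank y \<Longrightarrow> co x y * \<phi> (br x y) = 0"
begin

text \<open>Sorting the tail stays within the subalgebra, and since \<open>\<phi>\<close> kills brackets the commutator terms
  do not contribute.\<close>

lemma straight_subalgebra_tail:
  assumes "\<forall>z\<in>set t. 0 \<le> rank z" "ordered n" "\<forall>z\<in>set n. rank z < 0"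
  shows "straight (n @ t) = (if n = [] then prod_list (map \<phi> t) else 0)"
  using assms(1)
proof (induction t rule: wf_induct_rule[OF wf_smaller])
  case (1 t)
  show ?case
  proof (cases "ordered t")
    case True
    have "ordered (n @ t)"
      using True assms(2,3) 1(2) by (fastforce simp: sorted_append)
    moreover have "(\<forall>z\<in>set (n @ t). 0 \<le> rank z) \<longleftrightarrow> n = []"
      using assms(3) 1(2) by (cases n) auto
    ultimately show ?thesis by (simp add: straight_ordered)
  next
    case False
    then obtain u x y v where t: "t = u @ x # y # v" and lt: "rank y < rank x"
      using not_ordered_descent by blast
    have nonneg: "0 \<le> rank x" "0 \<le> rank y" using 1(2) t by auto
    have A: "straight (n @ u @ y # x # v) =
        (if n = [] then prod_list (map \<phi> (u @ y # x # v)) else 0)"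
      by (rule 1(1)) (use 1(2) t smaller_intros(2)[OF lt] in auto)
    have B: "co x y * straight (n @ u @ br x y # v) = 0"
    proof (cases "co x y = 0")
      case False
      have "straight (n @ u @ br x y # v) =
          (if n = [] then prod_list (map \<phi> (u @ br x y # v)) else 0)"
        by (rule 1(1)) (use 1(2) t br_closed[OF nonneg False] in \<open>auto intro: smaller_intros\<close>)
      then show ?thesis using \<phi>_bracket[OF nonneg] False by auto
    qed simp
    show ?thesis
      using straight_descent[OF lt, of "n @ u" v] A B t by simp
  qed
qed

text \<open>After straightening \<open>w\<close>, an appended letter of the subalgebra only has to be sorted into the tail.\<close>

lemma straight_snoc:
  assumes "0 \<le> rank z"
  shows "straight (w @ [z]) = \<phi> z * straight w"
proof (induction w rule: wf_induct_rule[OF wf_smaller])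
  case (1 w)
  show ?case
  proof (cases "ordered w")
    case True
    define n where "n = takeWhile (\<lambda>x. rank x < 0) w"
    define t where "t = dropWhile (\<lambda>x. rank x < 0) w"
    have w: "w = n @ t" by (simp add: n_def t_def)
    have "\<forall>x\<in>set n. rank x < 0" by (auto simp: n_def dest: set_takeWhileD)
    moreover have "\<forall>x\<in>set t. 0 \<le> rank x"
    proof (cases t)
      case (Cons a t')
      then have "0 \<le> rank a" unfolding t_def by (metis dropWhile_eq_Cons_conv not_le)
      then show ?thesis using True Cons w by (auto simp: sorted_append)
    qed simp
    moreover have "ordered n" using True w by (simp add: sorted_append)
    ultimately show ?thesis
      using straight_subalgebra_tail[of t n] straight_subalgebra_tail[of "t @ [z]" n] assms w by simp
  next
    case False
    then obtain u x y v where w: "w = u @ x # y # v" and lt: "rank y < rank x"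
      using not_ordered_descent by blast
    have "straight ((u @ y # x # v) @ [z]) = \<phi> z * straight (u @ y # x # v)"
      by (rule 1) (use w smaller_intros(2)[OF lt] in auto)
    moreover have "straight ((u @ br x y # v) @ [z]) = \<phi> z * straight (u @ br x y # v)"
      by (rule 1) (use w in \<open>auto intro: smaller_intros\<close>)
    ultimately show ?thesis
      using straight_descent[OF lt, of u v] straight_descent[OF lt, of u "v @ [z]"] w
      by (simp add: algebra_simps)
  qed
qed

lemma straight_Nil: "straight [] = 1"
  by (simp add: straight_ordered)

lemma straight_commutator:
  "straight (u @ x # y # v) = straight (u @ y # x # v) + co x y * straight (u @ br x y # v)"
proof (cases "rank x" "rank y" rule: linorder_cases)
  case equal
  then have "x = y" by (rule rank_inj)
  then show ?thesis by (simp add: co_self)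
next
  case less
  from straight_descent[OF less, of u v] show ?thesis
    by (simp add: co_swap[of y x] br_commute[of y x])
qed (rule straight_descent)

end

section \<open>The extended character\<close>

lemma sv_base_simps: "sv_base (L_basis n) = sv_L n" "sv_base (M_basis n) = sv_M n"
    "sv_base (Y_basis n) = sv_Y n"
  by (transfer; simp)+

lemma sv_induct [case_names zero base add scale]:
  assumes "P 0" "\<And>b. P (sv_base b)" "\<And>x y. P x \<Longrightarrow> P y \<Longrightarrow> P (x + y)" "\<And>c x. P x \<Longrightarrow> P (c *\<^sub>C x)"
  shows "P x"
proof -
  have "P (Abs_sv p)" for p
  proof (induction p rule: pm_induct)
    case zero
    then show ?case using assms(1) by (simp add: zero_sv_def)
  next
    case (single b c)
    have "Abs_sv (Poly_Mapping.single b c) = c *\<^sub>C sv_base b"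
      by (simp add: sv_base_def scaleC_sv.abs_eq eq_onp_same_args)
    then show ?case using assms(2,4) by simp
  next
    case (add p q)
    have "Abs_sv (p + q) = Abs_sv p + Abs_sv q"
      by (simp add: plus_sv.abs_eq eq_onp_same_args)
    then show ?case using assms(3) add by simp
  qed
  from this[of "Rep_sv x"] show ?thesis by (simp add: Rep_sv_inverse)
qed

lemma sv_base_in_sv_plus:
  assumes "0 \<le> basis_rank b" "b \<noteq> M_basis 0"
  shows "sv_base b \<in> complex_vs.span sv_plus_basis"
proof (rule complex_vs.span_base, cases b)
  case (M_basis n)
  with assms have "1 \<le> n" by (cases "n = 0") auto
  then show "sv_base b \<in> sv_plus_basis"
    using M_basis by (auto simp: sv_plus_basis_def sv_base_simps)
qed (use assms in \<open>auto simp: sv_plus_basis_def sv_base_simps\<close>)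

text \<open>The character of \<open>sv\<^sup>+ + \<complex> M\<^sub>0\<close>; outside this subalgebra its values are unspecified.\<close>

definition extended_character :: "(sv_plus \<Rightarrow> complex) \<Rightarrow> complex \<Rightarrow> sv_basis \<Rightarrow> complex" where
  "extended_character \<psi> \<xi> b = (if b = M_basis 0 then \<xi> else \<psi> (Abs_sv_plus (sv_base b)))"

lemma bracket_closed:
  assumes "0 \<le> basis_rank x" "0 \<le> basis_rank y" "bracket_coeff x y \<noteq> 0"
  shows "0 \<le> basis_rank (bracket_index x y)"
  using assms by (cases x; cases y) auto

lemma extended_character_bracket:
  assumes "lie_hom \<psi>" "0 \<le> basis_rank x" "0 \<le> basis_rank y"
  shows "bracket_coeff x y * extended_character \<psi> \<xi> (bracket_index x y) = 0"
proof (cases "bracket_coeff x y = 0")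
  case False
  have ne: "x \<noteq> M_basis 0" "y \<noteq> M_basis 0" "bracket_index x y \<noteq> M_basis 0"
    using False assms(2,3) by (cases x; cases y; auto)+
  let ?X = "Abs_sv_plus (sv_base x)" and ?Y = "Abs_sv_plus (sv_base y)"
    and ?Z = "Abs_sv_plus (sv_base (bracket_index x y))"
  note mem = sv_base_in_sv_plus[OF assms(2) ne(1)] sv_base_in_sv_plus[OF assms(3) ne(2)]
    sv_base_in_sv_plus[OF bracket_closed[OF assms(2,3) False] ne(3)]
  have "lie ?X ?Y = bracket_coeff x y *\<^sub>C ?Z"
    by (rule Rep_sv_plus_inject[THEN iffD1])
      (simp add: lie_sv_plus.rep_eq scaleC_sv_plus.rep_eq Abs_sv_plus_inverse mem lie_sv_base)
  then have "\<psi> (bracket_coeff x y *\<^sub>C ?Z) = lie (\<psi> ?X) (\<psi> ?Y)"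
    using assms(1) unfolding lie_hom_def by metis
  then have "bracket_coeff x y * \<psi> ?Z = 0"
    using assms(1) unfolding lie_hom_def by (simp add: scaleC_complex_def lie_complex_def)
  then show ?thesis using ne(3) by (simp add: extended_character_def)
qed simp

text \<open>These basis elements are multiples of brackets of \<open>L\<^sub>1\<close> with another element of \<open>sv\<^sup>+\<close>.\<close>

lemma extended_character_eq_0:
  assumes "lie_hom \<psi>"
  shows "3 \<le> n \<Longrightarrow> extended_character \<psi> \<xi> (L_basis n) = 0"
    and "2 \<le> n \<Longrightarrow> extended_character \<psi> \<xi> (M_basis n) = 0"
    and "2 \<le> n \<Longrightarrow> extended_character \<psi> \<xi> (Y_basis n) = 0"
proof -
  note vanish = extended_character_bracket[OF assms, of "L_basis 1" _ \<xi>]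
  have "n \<noteq> 1" "n \<noteq> 2" if "3 \<le> n" using that by auto
  then show "3 \<le> n \<Longrightarrow> extended_character \<psi> \<xi> (L_basis n) = 0"
    using vanish[of "L_basis (n - 1)"] by (simp flip: of_int_diff)
  show "2 \<le> n \<Longrightarrow> extended_character \<psi> \<xi> (M_basis n) = 0"
    using vanish[of "M_basis (n - 1)"] by (simp flip: of_int_diff)
  show "2 \<le> n \<Longrightarrow> extended_character \<psi> \<xi> (Y_basis n) = 0"
    using vanish[of "Y_basis (n - 1)"] by simp
qed

section \<open>A functional on the enveloping algebra\<close>

lemma free_const_simps:
  "free_const (a + b) = free_const a + free_const b"
  "free_const (a * b) = free_const a * free_const b"
  "free_const 0 = 0" "free_const 1 = 1"
  by (simp_all add: free_const_def single_add mult_single)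

definition coordinates :: "sv \<Rightarrow> sv_basis free_algebra" where
  "coordinates x = (\<Sum>b\<in>Poly_Mapping.keys (Rep_sv x).
     free_const (Poly_Mapping.lookup (Rep_sv x) b) * free_gen b)"

lemma coordinates_superset:
  assumes "finite A" "Poly_Mapping.keys (Rep_sv x) \<subseteq> A"
  shows "coordinates x = (\<Sum>b\<in>A. free_const (Poly_Mapping.lookup (Rep_sv x) b) * free_gen b)"
  unfolding coordinates_def
  by (rule sum.mono_neutral_left) (use assms in \<open>auto simp: in_keys_iff free_const_simps\<close>)

lemma coordinates_add: "coordinates (x + y) = coordinates x + coordinates y"
proof -
  let ?A = "Poly_Mapping.keys (Rep_sv x) \<union> Poly_Mapping.keys (Rep_sv y)"
  have "Poly_Mapping.keys (Rep_sv (x + y)) \<subseteq> ?A"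
    unfolding plus_sv.rep_eq by (rule keys_add)
  then show ?thesis
    by (simp add: coordinates_superset[of ?A] plus_sv.rep_eq lookup_add free_const_simps
        distrib_right sum.distrib)
qed

lemma coordinates_scale: "coordinates (c *\<^sub>C x) = free_const c * coordinates x"
proof -
  have "Poly_Mapping.keys (Rep_sv (c *\<^sub>C x)) \<subseteq> Poly_Mapping.keys (Rep_sv x)"
    unfolding scaleC_sv.rep_eq by (rule keys_pm_scale)
  then show ?thesis
    by (simp add: coordinates_superset[of "Poly_Mapping.keys (Rep_sv x)"] scaleC_sv.rep_eq
        free_const_simps sum_distrib_left mult.assoc)
qed

lemma coordinates_base: "coordinates (sv_base b) = free_gen b"
  by (simp add: coordinates_def sv_base.rep_eq free_const_simps)

lemma coordinates_zero: "coordinates 0 = 0"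
  using coordinates_add[of 0 0] by simp

text \<open>The free algebra that presents \<open>U\<close> has all elements of \<open>sv\<close> as generators, while straightening works
  with words in the basis.\<close>

definition in_basis :: "sv free_algebra \<Rightarrow> sv_basis free_algebra" where
  "in_basis = free_lift free_const coordinates"

lemma in_basis_simps:
  "in_basis (p + q) = in_basis p + in_basis q"
  "in_basis (p * q) = in_basis p * in_basis q"
  "in_basis (free_gen x) = coordinates x"
  "in_basis (free_const c) = free_const c"
  "in_basis 0 = 0" "in_basis 1 = 1"
proof -
  note add = free_lift_add[where s = free_const, OF free_const_simps(3,1)]
  note mult = free_lift_mult[where s = free_const, OF free_const_simps(3,1,2) free_const_central]
  note single = free_lift_single[where s = free_const, OF free_const_simps(3)]
  show "in_basis (p + q) = in_basis p + in_basis q" "in_basis (p * q) = in_basis p * in_basis q"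
    unfolding in_basis_def by (rule add, rule mult)
  show gen: "in_basis (free_gen x) = coordinates x" "in_basis (free_const c) = free_const c"
    for x c
    by (simp_all add: in_basis_def free_gen_def free_const_def[of c] single free_const_simps
        zero_free_monoid_def)
  show "in_basis 0 = 0" "in_basis 1 = 1"
    using gen(2)[of 0] gen(2)[of 1] by (simp_all only: free_const_simps)
qed

lemma in_basis_diff: "in_basis (p - q) = in_basis p - in_basis q"
  using in_basis_simps(1)[of "p - q" q] by simp

definition word_functional :: "('b list \<Rightarrow> complex) \<Rightarrow> 'b free_algebra \<Rightarrow> complex" where
  "word_functional f p = (\<Sum>w\<in>Poly_Mapping.keys p. Poly_Mapping.lookup p w * f (letters w))"

lemma word_functional_superset:
  assumes "finite A" "Poly_Mapping.keys p \<subseteq> A"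
  shows "word_functional f p = (\<Sum>w\<in>A. Poly_Mapping.lookup p w * f (letters w))"
  unfolding word_functional_def
  by (rule sum.mono_neutral_left) (use assms in \<open>auto simp: in_keys_iff\<close>)

lemma word_functional_single: "word_functional f (Poly_Mapping.single w c) = c * f (letters w)"
  by (subst word_functional_superset[of "{w}"]) simp_all

lemma word_functional_add: "word_functional f (p + q) = word_functional f p + word_functional f q"
proof -
  let ?A = "Poly_Mapping.keys p \<union> Poly_Mapping.keys q"
  have "Poly_Mapping.keys (p + q) \<subseteq> ?A" by (rule keys_add)
  then show ?thesis
    by (simp add: word_functional_superset[of ?A] lookup_add distrib_right sum.distrib)
qed

lemma word_functional_zero: "word_functional f 0 = 0"
  by (simp add: word_functional_def)

lemma word_functional_diff: "word_functional f (p - q) = word_functional f p - word_functional f q"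
  using word_functional_add[of f "p - q" q] by simp

lemma word_functional_const: "word_functional f (free_const c * p) = c * word_functional f p"
  by (induction p rule: pm_induct)
    (simp_all add: word_functional_zero word_functional_add distrib_left free_const_def
      mult_single word_functional_single)

text \<open>That is, \<open>f\<close> vanishes on the two-sided ideal generated by \<open>q\<close>.\<close>

definition vanishes_on_ideal :: "('b list \<Rightarrow> complex) \<Rightarrow> 'b free_algebra \<Rightarrow> bool" where
  "vanishes_on_ideal f q \<longleftrightarrow> (\<forall>r s. word_functional f (r * q * s) = 0)"

lemma vanishes_on_ideal_intros:
  "vanishes_on_ideal f 0"
  "vanishes_on_ideal f p \<Longrightarrow> vanishes_on_ideal f q \<Longrightarrow> vanishes_on_ideal f (p + q)"
  "vanishes_on_ideal f p \<Longrightarrow> vanishes_on_ideal f (p * q)"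
  "vanishes_on_ideal f p \<Longrightarrow> vanishes_on_ideal f (q * p)"
proof -
  show "vanishes_on_ideal f p \<Longrightarrow> vanishes_on_ideal f (p * q)"
    unfolding vanishes_on_ideal_def by (metis mult.assoc)
  show "vanishes_on_ideal f p \<Longrightarrow> vanishes_on_ideal f (q * p)"
    unfolding vanishes_on_ideal_def by (metis mult.assoc)
qed (simp_all add: vanishes_on_ideal_def word_functional_zero word_functional_add
    distrib_left distrib_right)

context
  fixes f :: "sv_basis list \<Rightarrow> complex"
  assumes f: "f (u @ x # y # v) = f (u @ y # x # v) + bracket_coeff x y * f (u @ bracket_index x y # v)"
begin

lemma vanishes_on_base_commutator:
  "vanishes_on_ideal f (free_gen x * free_gen y - free_gen y * free_gen x
     - free_const (bracket_coeff x y) * free_gen (bracket_index x y))"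
  unfolding vanishes_on_ideal_def
proof (intro allI)
  fix r s :: "sv_basis free_algebra"
  let ?q = "free_gen x * free_gen y - free_gen y * free_gen x
     - free_const (bracket_coeff x y) * free_gen (bracket_index x y)"
  show "word_functional f (r * ?q * s) = 0"
  proof (induction r rule: pm_induct)
    case (single u a)
    show ?case
    proof (induction s rule: pm_induct)
      case (single v b)
      show ?case
        using f[of "letters u" x y "letters v"]
        by (simp add: free_gen_def free_const_def mult_single right_diff_distrib
            left_diff_distrib word_functional_diff word_functional_add word_functional_single plus_free_monoid_def
            zero_free_monoid_def algebra_simps)
    qed (simp_all add: word_functional_zero word_functional_add distrib_left)
  qed (simp_all add: word_functional_zero word_functional_add distrib_right)
qed

lemma vanishes_on_commutator:
  "vanishes_on_ideal f (coordinates x * coordinates y - coordinates y * coordinates x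
     - coordinates (lie x y))"
proof (induction x rule: sv_induct)
  case (base a)
  show ?case
  proof (induction y rule: sv_induct)
    case (base b)
    show ?case
      using vanishes_on_base_commutator[of a b]
      by (simp add: lie_sv_base coordinates_scale coordinates_base)
  next
    case (add y z)
    from vanishes_on_ideal_intros(2)[OF this] show ?case
      by (simp add: coordinates_add lie_add_right algebra_simps)
  next
    case (scale c y)
    from vanishes_on_ideal_intros(4)[OF this, of "free_const c"] show ?case
      by (simp add: coordinates_scale lie_scaleC_right right_diff_distrib mult.assoc
          free_const_central[of c])
  qed (simp add: coordinates_zero vanishes_on_ideal_intros)
next
  case (add x z)
  from vanishes_on_ideal_intros(2)[OF this] show ?case
    by (simp add: coordinates_add lie_add_left algebra_simps)
next
  case (scale c x)
  from vanishes_on_ideal_intros(4)[OF this, of "free_const c"] show ?case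
    by (simp add: coordinates_scale lie_scaleC_left right_diff_distrib mult.assoc
        free_const_central[of c])
qed (simp add: coordinates_zero vanishes_on_ideal_intros)

lemma vanishes_on_uea_ideal:
  assumes "p \<in> ideal_gen uea_relations"
  shows "vanishes_on_ideal f (in_basis p)"
  using assms
proof (induction rule: ideal_gen.induct)
  case (gen p)
  then show ?case
    unfolding uea_relations_def
    by (auto simp: in_basis_diff in_basis_simps coordinates_add coordinates_scale
        vanishes_on_ideal_intros intro: vanishes_on_commutator)
qed (simp_all add: in_basis_simps vanishes_on_ideal_intros)

definition uea_functional :: "sv uea \<Rightarrow> complex" where
  "uea_functional u = word_functional f (in_basis (rep_uea u))"

lemma uea_functional_abs: "uea_functional (abs_uea p) = word_functional f (in_basis p)"
proof -
  have "uea_eq (rep_uea (abs_uea p)) p"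
    by (rule Quotient3_rep_abs[OF Quotient3_uea]) (simp add: uea_eq_def ideal_gen.zero)
  then have "vanishes_on_ideal f (in_basis (rep_uea (abs_uea p) - p))"
    unfolding uea_eq_def by (rule vanishes_on_uea_ideal)
  then have "word_functional f (1 * in_basis (rep_uea (abs_uea p) - p) * 1) = 0"
    unfolding vanishes_on_ideal_def by blast
  then show ?thesis
    by (simp add: uea_functional_def in_basis_diff word_functional_diff)
qed

end

lemma induced_character_sv:
  assumes "lie_hom \<psi>"
  shows "induced_character basis_rank bracket_index bracket_coeff (extended_character \<psi> \<xi>)"
proof
  fix x y z :: sv_basis and f :: "sv_basis \<Rightarrow> complex"
  show "bracket_coeff x y * (bracket_coeff (bracket_index x y) z * f (bracket_index (bracket_index x y) z))
    + bracket_coeff y z * (bracket_coeff (bracket_index y z) x * f (bracket_index (bracket_index y z) x))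
    + bracket_coeff z x * (bracket_coeff (bracket_index z x) y * f (bracket_index (bracket_index z x) y)) = 0"
    by (rule bracket_coeff_jacobi)
qed (simp_all add: basis_rank_inj bracket_index_commute bracket_closed
    extended_character_bracket assms, rule bracket_coeff_swap)

text \<open>The straightened values descend to \<open>U\<close> because they respect commutators.  This functional detects that
  the Whittaker vector of \<open>L\<close> is nonzero.\<close>

lemma uea_functional_exists:
  assumes "lie_hom \<psi>"
  obtains \<omega> :: "sv uea \<Rightarrow> complex" where
    "\<And>u v. \<omega> (u + v) = \<omega> u + \<omega> v" "\<And>c u. \<omega> (uea_const c * u) = c * \<omega> u" "\<omega> 1 = 1"
    "\<And>u b. 0 \<le> basis_rank b \<Longrightarrow>
       \<omega> (u * uea_gen (sv_base b)) = extended_character \<psi> \<xi> b * \<omega> u"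
proof -
  interpret induced_character basis_rank bracket_index bracket_coeff "extended_character \<psi> \<xi>"
    by (rule induced_character_sv[OF assms])
  let ?S = "word_functional straight"
  let ?\<omega> = "uea_functional straight"
  note abs = uea_functional_abs[of straight, OF straight_commutator]
  have ind: "P u" if "\<And>p. P (abs_uea p)" for P :: "sv uea \<Rightarrow> bool" and u
    using that by (metis Quotient3_abs_rep[OF Quotient3_uea])
  show thesis
  proof (rule that[of ?\<omega>])
    show "?\<omega> (u + v) = ?\<omega> u + ?\<omega> v" for u v
    proof (induction u rule: ind, induction v rule: ind)
      fix p q :: "sv free_algebra"
      show "?\<omega> (abs_uea q + abs_uea p) = ?\<omega> (abs_uea q) + ?\<omega> (abs_uea p)"
        by (simp add: plus_uea.abs_eq abs in_basis_simps word_functional_add)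
    qed
    show "?\<omega> (uea_const c * u) = c * ?\<omega> u" for c u
      by (induction u rule: ind)
        (simp add: uea_const.abs_eq times_uea.abs_eq abs in_basis_simps
          word_functional_const)
    show "?\<omega> 1 = 1"
      by (simp add: one_uea.abs_eq abs in_basis_simps word_functional_single[of _ 0 1, simplified]
          zero_free_monoid_def straight_Nil)
    show "?\<omega> (u * uea_gen (sv_base b)) = extended_character \<psi> \<xi> b * ?\<omega> u"
      if "0 \<le> basis_rank b" for u b
    proof -
      have *: "?S (p * free_gen b) = extended_character \<psi> \<xi> b * ?S p" for p
        by (induction p rule: pm_induct)
          (simp_all add: word_functional_zero word_functional_add distrib_left distrib_right
            free_gen_def mult_single word_functional_single plus_free_monoid_def
            straight_snoc that)
      show ?thesis
        by (induction u rule: ind)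
          (simp add: uea_gen.abs_eq times_uea.abs_eq abs in_basis_simps
            coordinates_base *)
    qed
  qed
qed

section \<open>Maximality of the Whittaker left ideal\<close>

lemma uea_const_zero: "uea_const 0 = 0"
  using uea_const_hom(1)[of 0 0] by simp

interpretation uea_vs: vector_space "\<lambda>c u. uea_const c * (u :: 'a::complex_lie_algebra uea)"
  by unfold_locales (simp_all add: uea_const_hom distrib_left distrib_right mult.assoc)

lemma uea_const_pull:
  "uea_gen x * (uea_const c * u) = uea_const c * (uea_gen x * u)"
  "uea_const c * (uea_const d * u) = uea_const d * (uea_const c * u)"
  by (metis mult.assoc uea_const_central)+

abbreviation gen_base :: "sv_basis \<Rightarrow> sv uea" where
  "gen_base b \<equiv> uea_gen (sv_base b)"

lemma gen_base_commute:
  "gen_base x * gen_base y =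
     gen_base y * gen_base x + uea_const (bracket_coeff x y) * gen_base (bracket_index x y)"
  using uea_gen_hom(3)[of "sv_base x" "sv_base y"] by (simp add: lie_sv_base uea_gen_hom(2))

lemma uea_sv_induct [case_names zero one gen_base add scale]:
  assumes "P 0" "P 1" "\<And>b u. P u \<Longrightarrow> P (gen_base b * u)" "\<And>u v. P u \<Longrightarrow> P v \<Longrightarrow> P (u + v)"
    "\<And>c u. P u \<Longrightarrow> P (uea_const c * u)"
  shows "P u"
proof -
  have gen: "P (uea_gen x * u)" if "P u" for x u
  proof (induction x rule: sv_induct)
    case zero
    have "uea_gen (0 :: sv) = 0" using uea_gen_hom(1)[of "0 :: sv" 0] by simp
    then show ?case using assms(1) by simp
  qed (use assms that in \<open>simp_all add: uea_gen_hom distrib_right mult.assoc\<close>)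
  have word: "P (abs_uea (Poly_Mapping.single (Word l) 1))" for l :: "sv list"
  proof (induction l)
    case Nil
    then show ?case using assms(2) by (simp add: one_uea.abs_eq zero_free_monoid_def flip: single_one)
  next
    case (Cons x l)
    have "abs_uea (Poly_Mapping.single (Word (x # l)) 1) =
        uea_gen x * abs_uea (Poly_Mapping.single (Word l) 1)"
      by (simp add: uea_gen.abs_eq times_uea.abs_eq free_gen_def mult_single
          plus_free_monoid_def)
    then show ?case using gen Cons by simp
  qed
  have "P (abs_uea p)" for p
  proof (induction p rule: pm_induct)
    case zero
    then show ?case using assms(1) by (simp add: zero_uea.abs_eq)
  next
    case (single w c)
    have "abs_uea (Poly_Mapping.single w c) =
        uea_const c * abs_uea (Poly_Mapping.single (Word (letters w)) 1)"
      by (simp add: uea_const.abs_eq times_uea.abs_eq free_const_def mult_single)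
    then show ?case using assms(5)[OF word[of "letters w"]] by simp
  next
    case (add p q)
    then show ?case
      using assms(4)[of "abs_uea p" "abs_uea q"] by (simp add: plus_uea.abs_eq)
  qed
  then show ?thesis by (metis Quotient3_abs_rep[OF Quotient3_uea])
qed

subsection \<open>Weights and dual letters\<close>

text \<open>The weights are arranged such that a commutator costs 4, negative letters have positive weight, and
  \<open>M\<^sub>1\<close> is lighter than every other letter at which the extended character may be nonzero.\<close>

fun weight :: "sv_basis \<Rightarrow> int" where
  "weight (L_basis n) = 4 - 2 * n"
| "weight (M_basis n) = - 2 * n"
| "weight (Y_basis n) = 1 - 2 * n"

lemma weight_bracket:
  "bracket_coeff x y \<noteq> 0 \<Longrightarrow> weight (bracket_index x y) = weight x + weight y - 4"
  by (cases x; cases y) auto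

lemma weight_pos: "basis_rank y < 0 \<Longrightarrow> 1 \<le> weight y"
  by (cases y) auto

lemma bracket_negative:
  "basis_rank x < 0 \<Longrightarrow> basis_rank y < 0 \<Longrightarrow> bracket_coeff x y \<noteq> 0 \<Longrightarrow>
     basis_rank (bracket_index x y) < 0"
  by (cases x; cases y) auto

lemma finite_negative_weight: "finite {x. basis_rank x < 0 \<and> weight x \<le> d}"
proof (rule finite_subset)
  let ?R = "{- \<bar>d\<bar> - 4..4}"
  show "{x. basis_rank x < 0 \<and> weight x \<le> d} \<subseteq> L_basis ` ?R \<union> M_basis ` ?R \<union> Y_basis ` ?R"
  proof
    fix x assume "x \<in> {x. basis_rank x < 0 \<and> weight x \<le> d}"
    then show "x \<in> L_basis ` ?R \<union> M_basis ` ?R \<union> Y_basis ` ?R"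
      by (cases x) auto
  qed
qed auto

text \<open>For a negative letter, the one letter whose bracket with it is a nonzero multiple of \<open>M\<^sub>1\<close>.\<close>

fun dual_letter :: "sv_basis \<Rightarrow> sv_basis" where
  "dual_letter (L_basis n) = M_basis (1 - n)"
| "dual_letter (M_basis n) = L_basis (1 - n)"
| "dual_letter (Y_basis n) = Y_basis (- n)"

lemma weight_dual: "weight (dual_letter x) = 2 - weight x"
  by (cases x) auto

lemma dual_rank: "basis_rank x < 0 \<Longrightarrow> 0 \<le> basis_rank (dual_letter x)"
  by (cases x) auto

lemma dual_bracket:
  assumes "basis_rank x < 0"
  shows "bracket_coeff (dual_letter x) x \<noteq> 0" "bracket_index (dual_letter x) x = M_basis 1"
  using assms by (cases x; auto)+

lemma dual_unique:
  "bracket_coeff (dual_letter x) y \<noteq> 0 \<Longrightarrow> bracket_index (dual_letter x) y = M_basis 1 \<Longrightarrow> y = x"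
  by (cases x; cases y) auto

lemma extended_character_weight:
  assumes "lie_hom \<psi>" "extended_character \<psi> \<xi> z \<noteq> 0"
  shows "z = M_basis 1 \<or> - 1 \<le> weight z"
proof (cases z)
  case (L_basis n)
  with assms(2) have "\<not> 3 \<le> n" using extended_character_eq_0(1)[OF assms(1), of n] by auto
  then show ?thesis using L_basis by simp
next
  case (M_basis n)
  with assms(2) have "\<not> 2 \<le> n" using extended_character_eq_0(2)[OF assms(1), of n] by auto
  then show ?thesis using M_basis by (cases "n = 1") auto
next
  case (Y_basis n)
  with assms(2) have "\<not> 2 \<le> n" using extended_character_eq_0(3)[OF assms(1), of n] by auto
  then show ?thesis using Y_basis by simp
qed

text \<open>In the application \<open>I\<close> is the annihilator of the Whittaker vector.\<close>

locale whittaker_left_ideal =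
  fixes \<psi> :: "sv_plus \<Rightarrow> complex" and \<xi> :: complex and I :: "sv uea set"
  assumes hom: "lie_hom \<psi>"
    and M1: "extended_character \<psi> \<xi> (M_basis 1) \<noteq> 0"
    and I_zero: "0 \<in> I"
    and I_add: "u \<in> I \<Longrightarrow> v \<in> I \<Longrightarrow> u + v \<in> I"
    and I_mult: "u \<in> I \<Longrightarrow> r * u \<in> I"
    and I_character:
      "0 \<le> basis_rank z \<Longrightarrow> gen_base z - uea_const (extended_character \<psi> \<xi> z) \<in> I"
begin

abbreviation \<phi> :: "sv_basis \<Rightarrow> complex" where
  "\<phi> \<equiv> extended_character \<psi> \<xi>"

abbreviation word :: "sv_basis list \<Rightarrow> sv uea" where
  "word q \<equiv> prod_list (map gen_base q)"

abbreviation negative :: "sv_basis list \<Rightarrow> bool" where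
  "negative q \<equiv> \<forall>y\<in>set q. basis_rank y < 0"

abbreviation word_weight :: "sv_basis list \<Rightarrow> int" where
  "word_weight q \<equiv> sum_list (map weight q)"

lemma word_weight_nonneg: "negative q \<Longrightarrow> int (length q) \<le> word_weight q"
proof (induction q)
  case (Cons y q)
  then show ?case using weight_pos[of y] by simp
qed simp

lemma letter_weight_le: "negative q \<Longrightarrow> y \<in> set q \<Longrightarrow> weight y \<le> word_weight q"
proof (induction q)
  case (Cons a q)
  then show ?case using weight_pos[of a] word_weight_nonneg[of q] by auto
qed simp

definition span_words :: "(sv_basis list \<Rightarrow> bool) \<Rightarrow> sv uea set" where
  "span_words P = uea_vs.span (I \<union> {word q | q. negative q \<and> P q})"

abbreviation filt :: "int \<Rightarrow> sv uea set" where
  "filt d \<equiv> span_words (\<lambda>q. word_weight q \<le> d)"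

lemma span_words_closed:
  "0 \<in> span_words P"
  "u \<in> span_words P \<Longrightarrow> v \<in> span_words P \<Longrightarrow> u + v \<in> span_words P"
  "u \<in> span_words P \<Longrightarrow> v \<in> span_words P \<Longrightarrow> u - v \<in> span_words P"
  "u \<in> span_words P \<Longrightarrow> uea_const c * u \<in> span_words P"
  "(\<And>x. x \<in> A \<Longrightarrow> f x \<in> span_words P) \<Longrightarrow> sum f A \<in> span_words P"
  unfolding span_words_def
  by (rule uea_vs.span_zero uea_vs.span_add uea_vs.span_diff uea_vs.span_scale uea_vs.span_sum;
      assumption)+

lemma span_words_ideal: "u \<in> I \<Longrightarrow> u \<in> span_words P"
  unfolding span_words_def by (simp add: uea_vs.span_base)

lemma span_words_word: "negative q \<Longrightarrow> P q \<Longrightarrow> word q \<in> span_words P"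
  unfolding span_words_def by (rule uea_vs.span_base) blast

lemma span_words_map:
  assumes "u \<in> span_words P" "\<And>u v. T (u + v) = T u + T v"
    "\<And>c u. T (uea_const c * u) = uea_const c * T u"
    "\<And>u. u \<in> I \<Longrightarrow> T u \<in> span_words Q"
    "\<And>q. negative q \<Longrightarrow> P q \<Longrightarrow> T (word q) \<in> span_words Q"
  shows "T u \<in> span_words Q"
  using assms(1) unfolding span_words_def[of P]
proof (induction rule: uea_vs.span_induct_alt)
  case base
  have "T 0 = 0" using assms(2)[of 0 0] by simp
  then show ?case by (simp add: span_words_closed)
next
  case (step c x y)
  then show ?case using assms(2-5) by (auto intro!: span_words_closed)
qed

lemma span_words_mono:
  "u \<in> span_words P \<Longrightarrow> (\<And>q. negative q \<Longrightarrow> P q \<Longrightarrow> Q q) \<Longrightarrow> u \<in> span_words Q"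
  by (rule span_words_map[where T = "\<lambda>u. u" and P = P and Q = Q]) (auto intro: span_words_ideal span_words_word)

lemma filt_mono: "u \<in> filt d \<Longrightarrow> d \<le> d' \<Longrightarrow> u \<in> filt d'"
  by (erule span_words_mono) simp

text \<open>The words are unordered products, so prepending a negative letter gives such a word again.\<close>

lemma filt_gen_base: "basis_rank y < 0 \<Longrightarrow> u \<in> filt d \<Longrightarrow> weight y + d \<le> d' \<Longrightarrow> gen_base y * u \<in> filt d'"
proof (erule span_words_map)
  fix q assume "basis_rank y < 0" "weight y + d \<le> d'" "negative q" "word_weight q \<le> d"
  then show "gen_base y * word q \<in> filt d'"
    using span_words_word[of "y # q" "\<lambda>q. word_weight q \<le> d'"] by simp
qed (auto simp: distrib_left uea_const_pull intro: span_words_ideal I_mult)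

subsection \<open>The lowering operators\<close>

text \<open>If \<open>z\<close> has nonnegative rank, this operator maps the generator 1 into \<open>I\<close>, so on a word only its
  commutators with the letters matter.\<close>

definition shifted :: "sv_basis \<Rightarrow> sv uea \<Rightarrow> sv uea" where
  "shifted z u = gen_base z * u - uea_const (\<phi> z) * u"

lemma shifted_add: "shifted z (u + v) = shifted z u + shifted z v"
  by (simp add: shifted_def algebra_simps)

lemma shifted_const: "shifted z (uea_const c * u) = uea_const c * shifted z u"
  by (simp add: shifted_def right_diff_distrib uea_const_pull)

lemma I_diff: "u \<in> I \<Longrightarrow> v \<in> I \<Longrightarrow> u - v \<in> I"
  using I_add[of u "- v"] I_mult[of v "- 1"] by simp

lemma I_sum: "(\<And>x. x \<in> A \<Longrightarrow> f x \<in> I) \<Longrightarrow> sum f A \<in> I"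
  by (induction A rule: infinite_finite_induct) (simp_all add: I_zero I_add)

lemma shifted_ideal: "u \<in> I \<Longrightarrow> shifted z u \<in> I"
  unfolding shifted_def by (intro I_diff I_mult)

lemma shifted_gen_base:
  "shifted z (gen_base y * u) = gen_base y * shifted z u +
     uea_const (bracket_coeff z y) * (gen_base (bracket_index z y) * u)"
proof -
  have "gen_base z * (gen_base y * u) = gen_base y * (gen_base z * u) +
     uea_const (bracket_coeff z y) * (gen_base (bracket_index z y) * u)"
    unfolding mult.assoc[symmetric] gen_base_commute[of z y] by (simp add: distrib_right)
  then show ?thesis
    by (simp add: shifted_def right_diff_distrib uea_const_pull)
qed

text \<open>The scalar by which \<open>[z, y]\<close> acts on the generator as far as its \<open>M\<^sub>1\<close>-component is concerned.\<close>

definition pairing :: "sv_basis \<Rightarrow> sv_basis \<Rightarrow> complex" where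
  "pairing z y = (if bracket_index z y = M_basis 1 then bracket_coeff z y * \<phi> (M_basis 1) else 0)"

text \<open>The bracket \<open>g = [z, y]\<close> has weight \<open>weight z + weight y - 4\<close>.  If \<open>g\<close> is a negative letter, it
  contributes that weight.  Otherwise it contributes \<open>\<phi>(g)\<close> up to terms covered by the second hypothesis,
  and \<open>\<phi>(g) \<noteq> 0\<close> forces \<open>g = M\<^sub>1\<close> or weight at least \<open>-1\<close>; the former is the subtracted term.\<close>

lemma bracket_term:
  assumes q: "negative q"
    and lower: "\<And>z. 0 \<le> basis_rank z \<Longrightarrow> shifted z (word q) \<in> filt (word_weight q + weight z - 2)"
  shows "uea_const (bracket_coeff z y) * (gen_base (bracket_index z y) * word q)
     - uea_const (pairing z y) * word q \<in> filt (word_weight q + weight z + weight y - 3)"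
    (is "?d \<in> filt ?n")
proof (cases "bracket_coeff z y = 0")
  case True
  then show ?thesis by (simp add: pairing_def uea_const_zero span_words_closed)
next
  case False
  let ?g = "bracket_index z y"
  note w = weight_bracket[OF False]
  show ?thesis
  proof (cases "basis_rank ?g < 0")
    case True
    then have "gen_base ?g * word q \<in> filt ?n"
      using q w by (intro filt_gen_base[of _ _ "word_weight q"] span_words_word) auto
    moreover have "pairing z y = 0" using True by (auto simp: pairing_def)
    ultimately show ?thesis by (simp add: uea_const_zero span_words_closed)
  next
    case False
    then have "shifted ?g (word q) \<in> filt ?n"
      using lower[of ?g] w by (auto intro: filt_mono)
    moreover have "uea_const (\<phi> ?g) * word q \<in> filt ?n" if "?g \<noteq> M_basis 1"
    proof (cases "\<phi> ?g = 0")
      case True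
      then show ?thesis by (simp add: uea_const_zero span_words_closed)
    next
      case nz: False
      have "- 1 \<le> weight ?g"
        using extended_character_weight[OF hom nz] that by auto
      then show ?thesis using w q by (intro span_words_closed span_words_word) auto
    qed
    ultimately have "shifted ?g (word q) +
        (if ?g = M_basis 1 then 0 else uea_const (\<phi> ?g) * word q) \<in> filt ?n"
      by (cases "?g = M_basis 1") (simp_all add: span_words_closed(2))
    moreover have "?d = uea_const (bracket_coeff z y) * (shifted ?g (word q) +
        (if ?g = M_basis 1 then 0 else uea_const (\<phi> ?g) * word q))"
    proof (cases "?g = M_basis 1")
      case True
      then have "pairing z y = bracket_coeff z y * \<phi> ?g" by (simp only: pairing_def simp_thms if_True)
      with True show ?thesis
        by (simp only: simp_thms if_True shifted_def uea_const_hom(2) right_diff_distrib mult.assoc add_0_right)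
    next
      case False
      then have "pairing z y = 0" by (simp only: pairing_def if_False)
      with False show ?thesis
        by (simp only: if_False shifted_def uea_const_zero mult_zero_left diff_add_cancel diff_0_right)
    qed
    ultimately show ?thesis by (simp only: span_words_closed(4))
  qed
qed

lemma pairing_weight: "pairing z y \<noteq> 0 \<Longrightarrow> weight z + weight y = 2"
  using weight_bracket[of z y] by (auto simp: pairing_def split: if_splits)

lemma shifted_word:
  assumes "negative q" "0 \<le> basis_rank z"
  shows "shifted z (word q) \<in> filt (word_weight q + weight z - 2)"
  using assms
proof (induction q arbitrary: z)
  case Nil
  then show ?case
    using I_character[of z] by (auto simp: shifted_def intro: span_words_ideal)
next
  case (Cons y q)
  let ?n = "word_weight (y # q) + weight z - 2"
  have A: "gen_base y * shifted z (word q) \<in> filt ?n"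
    using Cons by (intro filt_gen_base[OF _ Cons.IH]) auto
  have B: "uea_const (bracket_coeff z y) * (gen_base (bracket_index z y) * word q)
     - uea_const (pairing z y) * word q \<in> filt ?n"
    by (rule filt_mono[OF bracket_term]) (use Cons in auto)
  have C: "uea_const (pairing z y) * word q \<in> filt ?n"
  proof (cases "pairing z y = 0")
    case False
    then show ?thesis
      using pairing_weight[OF False] Cons.prems by (intro span_words_closed span_words_word) auto
  qed (simp add: uea_const_zero span_words_closed)
  show ?case
    using span_words_closed(2)[OF A span_words_closed(2)[OF B C]]
    by (simp add: shifted_gen_base)
qed

lemma shifted_filt:
  assumes "u \<in> filt d" "0 \<le> basis_rank z"
  shows "shifted z u \<in> filt (d + weight z - 2)"
  using assms(1)
  by (rule span_words_map)
    (auto intro: shifted_add shifted_const span_words_ideal shifted_ideal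
      filt_mono[OF shifted_word] assms(2))

text \<open>The formal partial derivative of a word with respect to the letter \<open>x\<close>.\<close>

fun remove_letter :: "sv_basis \<Rightarrow> sv_basis list \<Rightarrow> sv uea" where
  "remove_letter x [] = 0"
| "remove_letter x (y # q) = (if y = x then word q else 0) + gen_base y * remove_letter x q"

lemma remove_letter_filt:
  assumes "negative q" "word_weight q - weight x \<le> d"
  shows "remove_letter x q \<in> filt d"
  using assms
proof (induction q arbitrary: d)
  case (Cons y q)
  have "gen_base y * remove_letter x q \<in> filt d"
    using Cons by (intro filt_gen_base[OF _ Cons.IH[of "d - weight y"]]) auto
  moreover have "word q \<in> filt d" if "y = x"
    using Cons.prems that by (intro span_words_word) auto
  ultimately show ?case by (auto intro!: span_words_closed)
qed (simp add: span_words_closed)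

definition lowering :: "sv_basis \<Rightarrow> sv uea \<Rightarrow> sv uea" where
  "lowering x u = uea_const (1 / pairing (dual_letter x) x) * shifted (dual_letter x) u"

lemma lowering_add: "lowering x (u + v) = lowering x u + lowering x v"
  by (simp add: lowering_def shifted_add distrib_left)

lemma lowering_const: "lowering x (uea_const c * u) = uea_const c * lowering x u"
  by (simp add: lowering_def shifted_const uea_const_pull)

lemma lowering_ideal: "u \<in> I \<Longrightarrow> lowering x u \<in> I"
  unfolding lowering_def by (intro I_mult shifted_ideal)

lemma lowering_filt:
  assumes "u \<in> filt d" "basis_rank x < 0"
  shows "lowering x u \<in> filt (d - weight x)"
  unfolding lowering_def
  using shifted_filt[OF assms(1) dual_rank[OF assms(2)]]
  by (auto intro!: span_words_closed simp: weight_dual)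

lemma pairing_dual:
  assumes "basis_rank x < 0"
  shows "pairing (dual_letter x) y = 0 \<longleftrightarrow> y \<noteq> x"
  using dual_bracket[OF assms] dual_unique[of x y] M1 by (auto simp: pairing_def)

lemma shifted_dual_word:
  assumes "negative q" "basis_rank x < 0"
  shows "shifted (dual_letter x) (word q) - uea_const (pairing (dual_letter x) x) * remove_letter x q
     \<in> filt (word_weight q - weight x - 1)"
  using assms(1)
proof (induction q)
  case Nil
  have "shifted (dual_letter x) (word []) \<in> I"
    using I_character[OF dual_rank[OF assms(2)]] by (simp add: shifted_def)
  then show ?case by (simp add: span_words_ideal)
next
  case (Cons y q)
  let ?n = "word_weight (y # q) - weight x - 1" and ?z = "dual_letter x"
  have A: "gen_base y * (shifted ?z (word q) - uea_const (pairing ?z x) * remove_letter x q) \<in> filt ?n"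
    using Cons by (intro filt_gen_base[OF _ Cons.IH]) auto
  have B: "uea_const (bracket_coeff ?z y) * (gen_base (bracket_index ?z y) * word q)
     - uea_const (pairing ?z y) * word q \<in> filt ?n"
    by (rule filt_mono[OF bracket_term]) (use Cons in \<open>auto intro: shifted_word simp: weight_dual\<close>)
  have "uea_const (pairing ?z y) * word q = uea_const (pairing ?z x) * (if y = x then word q else 0)"
    using pairing_dual[OF assms(2), of y] by (auto simp: uea_const_zero)
  then show ?case
    using span_words_closed(2)[OF A B]
    by (simp add: shifted_gen_base distrib_left right_diff_distrib uea_const_pull
        algebra_simps)
qed

text \<open>By \<open>bracket_term\<close> each letter \<open>y\<close> of the word contributes its pairing with the dual of \<open>x\<close>, and
  this pairing is nonzero only for \<open>y = x\<close>.\<close>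

lemma lowering_word:
  assumes "negative q" "basis_rank x < 0"
  shows "lowering x (word q) - remove_letter x q \<in> filt (word_weight q - weight x - 1)"
proof -
  let ?k = "pairing (dual_letter x) x"
  have "?k \<noteq> 0" using pairing_dual[OF assms(2)] by simp
  then have "uea_const (1 / ?k) * (uea_const ?k * remove_letter x q) = remove_letter x q"
    by (simp add: uea_const_hom flip: mult.assoc uea_const_hom(2))
  then have "lowering x (word q) - remove_letter x q =
      uea_const (1 / ?k) * (shifted (dual_letter x) (word q) - uea_const ?k * remove_letter x q)"
    by (simp add: lowering_def right_diff_distrib)
  then show ?thesis
    using shifted_dual_word[OF assms] by (simp add: span_words_closed)
qed

subsection \<open>The Euler operator\<close>

definition euler :: "sv_basis set \<Rightarrow> sv uea \<Rightarrow> sv uea" where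
  "euler S u = (\<Sum>x\<in>S. gen_base x * lowering x u)"

lemma euler_add: "euler S (u + v) = euler S u + euler S v"
  by (simp add: euler_def lowering_add distrib_left sum.distrib)

lemma euler_const: "euler S (uea_const c * u) = uea_const c * euler S u"
  by (simp add: euler_def lowering_const sum_distrib_left uea_const_pull)

text \<open>Euler's identity for homogeneous polynomials; moving \<open>x\<close> past the letters in front of it costs
  commutators, which have lower weight.\<close>

lemma sum_remove_letter:
  assumes "finite S" "\<forall>x\<in>S. basis_rank x < 0" "set q \<subseteq> S"
  shows "(\<Sum>x\<in>S. gen_base x * remove_letter x q) - uea_const (of_nat (length q)) * word q
     \<in> filt (word_weight q - 1)"
  using assms(3)
proof (induction q)
  case Nil
  then show ?case by (simp add: uea_const_zero span_words_closed)
next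
  case (Cons y q)
  let ?n = "word_weight (y # q) - 1"
  have y: "y \<in> S" "basis_rank y < 0" and q: "negative q" using Cons.prems assms(2) by auto
  have A: "gen_base y * ((\<Sum>x\<in>S. gen_base x * remove_letter x q)
      - uea_const (of_nat (length q)) * word q) \<in> filt ?n"
    using Cons y by (intro filt_gen_base[OF _ Cons.IH]) auto
  have B: "(\<Sum>x\<in>S. uea_const (bracket_coeff x y) *
      (gen_base (bracket_index x y) * remove_letter x q)) \<in> filt ?n"
  proof (rule span_words_closed)
    fix x assume x: "x \<in> S"
    show "uea_const (bracket_coeff x y) * (gen_base (bracket_index x y) * remove_letter x q) \<in> filt ?n"
    proof (cases "bracket_coeff x y = 0")
      case False
      have "gen_base (bracket_index x y) * remove_letter x q \<in> filt ?n"
        by (rule filt_gen_base[OF bracket_negative remove_letter_filt[OF q order_refl]])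
          (use x y assms(2) False weight_bracket[OF False] in auto)
      then show ?thesis by (rule span_words_closed)
    qed (simp add: uea_const_zero span_words_closed)
  qed
  have comm: "gen_base x * (gen_base y * r) = gen_base y * (gen_base x * r) +
      uea_const (bracket_coeff x y) * (gen_base (bracket_index x y) * r)" for x r
    unfolding mult.assoc[symmetric] gen_base_commute[of x y] by (simp add: distrib_right)
  have "(\<Sum>x\<in>S. gen_base x * (if y = x then word q else 0)) = gen_base y * word q"
    using assms(1) y(1) by (simp add: if_distrib[of "(*) _"] cong: if_cong)
  then have "(\<Sum>x\<in>S. gen_base x * remove_letter x (y # q)) = gen_base y * word q +
      gen_base y * (\<Sum>x\<in>S. gen_base x * remove_letter x q) +
      (\<Sum>x\<in>S. uea_const (bracket_coeff x y) * (gen_base (bracket_index x y) * remove_letter x q))"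
    by (simp add: distrib_left sum.distrib comm sum_distrib_left)
  then show ?case
    using span_words_closed(2)[OF A B]
    by (simp add: uea_const_hom distrib_left distrib_right right_diff_distrib
        uea_const_pull algebra_simps)
qed

lemma euler_word:
  assumes "finite S" "\<forall>x\<in>S. basis_rank x < 0" "set q \<subseteq> S"
  shows "euler S (word q) - uea_const (of_nat (length q)) * word q \<in> filt (word_weight q - 1)"
proof -
  have "(\<Sum>x\<in>S. gen_base x * (lowering x (word q) - remove_letter x q)) \<in> filt (word_weight q - 1)"
  proof (rule span_words_closed)
    fix x assume "x \<in> S"
    then show "gen_base x * (lowering x (word q) - remove_letter x q) \<in> filt (word_weight q - 1)"
      using assms by (intro filt_gen_base[OF _ lowering_word]) auto
  qed
  from span_words_closed(2)[OF this sum_remove_letter[OF assms]] show ?thesis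
    by (simp add: euler_def right_diff_distrib sum_subtractf)
qed

lemma euler_filt:
  assumes "\<forall>x\<in>S. basis_rank x < 0" "u \<in> filt d"
  shows "euler S u \<in> filt d"
  unfolding euler_def
proof (rule span_words_closed)
  fix x assume "x \<in> S"
  then show "gen_base x * lowering x u \<in> filt d"
    using assms by (intro filt_gen_base[OF _ lowering_filt]) auto
qed

subsection \<open>Induction on weight and length\<close>

text \<open>The refinement of the filtration that interpolates between the weights \<open>d - 1\<close> and \<open>d\<close>.\<close>

abbreviation filt_length :: "int \<Rightarrow> nat \<Rightarrow> sv uea set" where
  "filt_length d n \<equiv> span_words (\<lambda>q. word_weight q < d \<or> word_weight q = d \<and> length q \<le> n)"

text \<open>Words of weight \<open>d\<close> and length \<open>n + 1\<close> are eigenvectors with eigenvalue \<open>n + 1\<close> up to lower weight, so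
  they cancel.  Only letters of weight at most \<open>d\<close> can occur in a word of weight \<open>d\<close>, which keeps the
  Euler sum finite.\<close>

lemma euler_filt_length:
  assumes "u \<in> filt_length d (Suc n)"
  shows "euler {x. basis_rank x < 0 \<and> weight x \<le> d} u - uea_const (of_nat (Suc n)) * u
    \<in> filt_length d n" (is "?T u \<in> _")
  using assms
proof (rule span_words_map)
  let ?X = "{x. basis_rank x < 0 \<and> weight x \<le> d}"
  show "?T (u + v) = ?T u + ?T v" for u v by (simp add: euler_add algebra_simps)
  show "?T (uea_const c * u) = uea_const c * ?T u" for c u
    by (simp add: euler_const right_diff_distrib uea_const_pull)
  show "?T u \<in> filt_length d n" if "u \<in> I" for u
  proof -
    have "euler ?X u \<in> span_words Q" for Q
      unfolding euler_def using that
      by (intro span_words_closed span_words_ideal I_mult lowering_ideal)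
    from span_words_closed(3)[OF this span_words_closed(4)[OF span_words_ideal[OF that]]]
    show ?thesis .
  qed
  fix q assume q: "negative q"
    and "word_weight q < d \<or> word_weight q = d \<and> length q \<le> Suc n"
  then consider "word_weight q < d" | "word_weight q = d" "length q \<le> Suc n" by linarith
  then show "?T (word q) \<in> filt_length d n"
  proof cases
    case 1
    then have "word q \<in> filt (d - 1)" using q by (intro span_words_word) auto
    then have "?T (word q) \<in> filt (d - 1)" by (intro span_words_closed euler_filt) auto
    then show ?thesis by (rule span_words_mono) auto
  next
    case 2
    have "euler ?X (word q) - uea_const (of_nat (length q)) * word q \<in> filt (d - 1)"
      using euler_word[OF finite_negative_weight[of d], of q] 2 q letter_weight_le[OF q] by auto
    then have A: "euler ?X (word q) - uea_const (of_nat (length q)) * word q \<in> filt_length d n"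
      by (rule span_words_mono) auto
    have B: "uea_const (of_nat (length q)) * word q - uea_const (of_nat (Suc n)) * word q
        \<in> filt_length d n"
    proof (cases "length q = Suc n")
      case False
      then have "word q \<in> filt_length d n" using 2 q by (intro span_words_word) auto
      then show ?thesis by (intro span_words_closed)
    qed (simp add: span_words_closed)
    show ?thesis using span_words_closed(2)[OF A B] by simp
  qed
qed

text \<open>The union of the filtration contains 1 and is stable under left multiplication by every basis
  element: the negative ones prepend a letter, the others act through \<open>shifted\<close>.\<close>

lemma all_in_filt: "\<exists>d. u \<in> filt d"
proof (induction u rule: uea_sv_induct)
  case one
  show ?case using span_words_word[of "[]" "\<lambda>q. word_weight q \<le> 0"] by auto
next
  case (gen_base b u)
  then obtain d where u: "u \<in> filt d" by blast
  show ?case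
  proof (cases "basis_rank b < 0")
    case True
    then show ?thesis using filt_gen_base[OF True u order_refl] by blast
  next
    case False
    define d' where "d' = max d (d + weight b - 2)"
    have "shifted b u + uea_const (\<phi> b) * u \<in> filt d'"
      using False shifted_filt[OF u, of b] u
      by (intro span_words_closed) (auto simp: d'_def intro: filt_mono)
    then show ?thesis by (auto simp: shifted_def)
  qed
next
  case (add u v)
  then obtain d d' where "u \<in> filt d" "v \<in> filt d'" by blast
  then have "u + v \<in> filt (max d d')"
    by (intro span_words_closed) (auto intro: filt_mono)
  then show ?case by blast
qed (auto intro: span_words_closed)

lemma const_mult_cancel:
  assumes "c \<noteq> 0"
    and "\<And>r u. u \<in> J \<Longrightarrow> r * u \<in> J" and "uea_const c * u \<in> J"
  shows "(u :: sv uea) \<in> J"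
proof -
  have "uea_const (1 / c) * (uea_const c * u) = u"
    using assms(1) by (simp add: uea_const_hom flip: mult.assoc uea_const_hom(2))
  then show ?thesis using assms(2,3) by metis
qed

text \<open>Outer induction on the weight \<open>d\<close>, inner induction on the length.  For \<open>u \<in> J\<close> all lowering operators
  give elements of \<open>J\<close> of smaller weight, which lie in \<open>I\<close>.  So the Euler operator maps \<open>u\<close> into \<open>I\<close>,
  and comparing with \<open>euler_filt_length\<close> shortens \<open>u\<close>.\<close>

lemma maximal:
  assumes J_add: "\<And>u v. u \<in> J \<Longrightarrow> v \<in> J \<Longrightarrow> u + v \<in> J"
    and J_mult: "\<And>r u. u \<in> J \<Longrightarrow> r * u \<in> J"
    and sub: "I \<subseteq> J" and proper: "1 \<notin> J"
  shows "J = I"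
proof -
  have J_diff: "u - v \<in> J" if "u \<in> J" "v \<in> J" for u v
    using J_add[of u "- v"] J_mult[of v "- 1"] that by simp
  have J_const: "c = 0" if "uea_const c \<in> J" for c
    using const_mult_cancel[of c J 1] that J_mult proper by auto
  have main: "u \<in> I" if "u \<in> J" "u \<in> filt (int d)" for u d
    using that
  proof (induction d arbitrary: u rule: less_induct)
    case (less d)
    have lower: "u \<in> I" if "u \<in> J" "u \<in> filt e" "e < int d" "0 < d" for u e
    proof -
      have "u \<in> filt (int (nat e))" by (rule filt_mono[OF that(2)]) simp
      then show ?thesis using less.IH[of "nat e" u] that by auto
    qed
    show ?case
    proof (cases "d = 0")
      case True
      \<comment> \<open>The empty word is the only negative word of weight at most 0.\<close>
      have "\<exists>i\<in>I. \<exists>c. u = i + uea_const c"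
        using less.prems(2) unfolding span_words_def True
      proof (induction rule: uea_vs.span_induct_alt)
        case base
        show ?case using I_zero uea_const_zero by (metis add_0)
      next
        case (step a x y)
        then obtain i c where y: "i \<in> I" "y = i + uea_const c" by blast
        from step(1) consider "x \<in> I" | q where "x = word q" "negative q" "word_weight q \<le> 0" by auto
        then show ?case
        proof cases
          case 1
          then have "uea_const a * x + i \<in> I" using y I_add I_mult by blast
          then show ?thesis using y by (metis add.assoc)
        next
          case 2
          then have "length q = 0" using word_weight_nonneg[of q] by linarith
          then have "x = 1" using 2 by simp
          then have "uea_const a * x + y = i + uea_const (a + c)"
            using y by (simp add: uea_const_hom)
          then show ?thesis using y by blast
        qed
      qed
      then obtain i c where u: "i \<in> I" "u = i + uea_const c" by blast
      then have "uea_const c \<in> J" using J_diff[OF less.prems(1), of i] sub by auto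
      then show ?thesis using J_const u by (metis uea_const_zero add.right_neutral)
    next
      case False
      let ?X = "{x. basis_rank x < 0 \<and> weight x \<le> int d}"
      have "u \<in> I" if "u \<in> J" "u \<in> filt_length (int d) n" for u n
        using that
      proof (induction n arbitrary: u)
        case 0
        have "u \<in> filt (int d - 1)" using 0(2) by (rule span_words_mono) (use False in auto)
        then show ?case by (rule lower[OF 0(1)]) (use False in simp_all)
      next
        case (Suc n)
        have e: "euler ?X u \<in> I"
        proof -
          have "u \<in> filt (int d)" using Suc.prems(2) by (rule span_words_mono) auto
          then have *: "lowering x u \<in> filt (int d - weight x)" if "x \<in> ?X" for x
            using lowering_filt that by auto
          have "lowering x u \<in> J" for x
            unfolding lowering_def shifted_def by (intro J_mult J_diff Suc.prems(1))
          then have "lowering x u \<in> I" if "x \<in> ?X" for x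
            using lower[OF _ *[OF that]] weight_pos[of x] that False by auto
          then have "gen_base x * lowering x u \<in> I" if "x \<in> ?X" for x
            using that I_mult by blast
          then show ?thesis unfolding euler_def by (rule I_sum)
        qed
        have "uea_const (of_nat (Suc n)) * u \<in> filt_length (int d) n"
          using span_words_closed(3)[OF span_words_ideal[OF e] euler_filt_length[OF Suc.prems(2)]]
          by simp
        then have "uea_const (1 / of_nat (Suc n)) * (uea_const (of_nat (Suc n)) * u)
            \<in> filt_length (int d) n" by (rule span_words_closed)
        then have "u \<in> filt_length (int d) n"
          by (simp add: uea_const_hom(3) flip: mult.assoc uea_const_hom(2) del: of_nat_Suc)
        then show ?case using Suc by blast
      qed
      moreover have "u \<in> filt_length (int d) d"
        using less.prems(2)
      proof (rule span_words_mono)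
        fix q assume "negative q" "word_weight q \<le> int d"
        then show "word_weight q < int d \<or> word_weight q = int d \<and> length q \<le> d"
          using word_weight_nonneg[of q] by linarith
      qed
      ultimately show ?thesis using less.prems(1) by blast
    qed
  qed
  have "u \<in> I" if u: "u \<in> J" for u
  proof -
    obtain d where "u \<in> filt d" using all_in_filt by blast
    then have "u \<in> filt (int (nat d))" by (rule filt_mono) simp
    then show ?thesis using main u by blast
  qed
  then show ?thesis using sub by blast
qed

end

section \<open>Left modules and their quotients\<close>

text \<open>On the free abelian group that underlies a tensor product, scalars act additively in the vector but not
  in the scalar; additivity in the scalar holds only after passing to the quotient.  Hence the two
  locales.\<close>

locale monoid_action = abelian_group M for M :: "('r::ring_1, 'v) module" (structure) +
  assumes smult_closed [simp]: "x \<in> carrier M \<Longrightarrow> r \<odot> x \<in> carrier M"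
    and smult_add: "x \<in> carrier M \<Longrightarrow> y \<in> carrier M \<Longrightarrow> r \<odot> (x \<oplus> y) = r \<odot> x \<oplus> r \<odot> y"
    and mult_smult: "x \<in> carrier M \<Longrightarrow> (r * s) \<odot> x = r \<odot> (s \<odot> x)"
    and one_smult: "x \<in> carrier M \<Longrightarrow> 1 \<odot> x = x"
begin

lemma smult_zero: "r \<odot> \<zero> = \<zero>"
  using smult_add[of \<zero> \<zero> r] by (metis add.r_cancel_one' l_zero smult_closed zero_closed)

lemma smult_inv: "x \<in> carrier M \<Longrightarrow> r \<odot> (\<ominus> x) = \<ominus> (r \<odot> x)"
  by (metis add.inv_closed add.inv_equality l_neg smult_add smult_closed smult_zero)

end

locale left_module = monoid_action +
  assumes add_smult: "x \<in> carrier M \<Longrightarrow> (r + s) \<odot> x = r \<odot> x \<oplus> s \<odot> x"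
begin

lemma zero_smult: "x \<in> carrier M \<Longrightarrow> 0 \<odot> x = \<zero>"
  using add_smult[of x 0 0] by (metis add.r_cancel_one' add_0 smult_closed)

lemma diff_smult: "x \<in> carrier M \<Longrightarrow> (r - s) \<odot> x = r \<odot> x \<ominus> s \<odot> x"
proof -
  assume x: "x \<in> carrier M"
  have "r \<odot> x = (r - s) \<odot> x \<oplus> s \<odot> x"
    using add_smult[OF x, of "r - s" s] by simp
  then show ?thesis
    using x by (simp add: a_minus_def add.inv_solve_right)
qed

end

locale action_quotient = monoid_action M + additive_subgroup N M
  for M :: "('r::ring_1, 'v) module" (structure) and N +
  assumes smult_N: "x \<in> N \<Longrightarrow> r \<odot> x \<in> N"
begin

sublocale abelian_subgroup N M
  by (rule abelian_subgroupI3; unfold_locales)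

abbreviation Q :: "('r, 'v set) module" where
  "Q \<equiv> quot_module M N"

lemma carrier_quot: "carrier Q = {N +> x | x. x \<in> carrier M}"
  by (auto simp: quot_module_def A_RCOSETS_def' )

lemma zero_quot: "zero Q = N +> \<zero>"
  by (simp add: quot_module_def a_subset)

lemma add_quot:
  "x \<in> carrier M \<Longrightarrow> y \<in> carrier M \<Longrightarrow> (N +> x) \<oplus>\<^bsub>Q\<^esub> (N +> y) = N +> (x \<oplus> y)"
  by (simp add: quot_module_def a_rcos_sum)

lemma coset_add_left: "h \<in> N \<Longrightarrow> x \<in> carrier M \<Longrightarrow> N +> (h \<oplus> x) = N +> x"
  using a_coset_add_assoc[OF a_subset, of h x] a_rcos_const[of h] a_Hcarr[of h] by simp

lemma smult_quot:
  assumes "x \<in> carrier M"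
  shows "r \<odot>\<^bsub>Q\<^esub> (N +> x) = N +> (r \<odot> x)"
proof -
  have "N +> (r \<odot> y) = N +> (r \<odot> x)" if "y \<in> N +> x" for y
  proof -
    from that obtain h where h: "h \<in> N" "y = h \<oplus> x" by (auto simp: a_r_coset_def')
    then show ?thesis
      using assms by (simp add: smult_add coset_add_left smult_N a_Hcarr)
  qed
  then have "(\<Union>y\<in>N +> x. N +> (r \<odot> y)) = (\<Union>y\<in>N +> x. N +> (r \<odot> x))"
    by simp
  also have "\<dots> = N +> (r \<odot> x)" using a_rcos_self[OF assms] by blast
  finally show ?thesis by (simp add: quot_module_def)
qed

lemma coset_eq_iff:
  assumes "x \<in> carrier M" "y \<in> carrier M"
  shows "N +> x = N +> y \<longleftrightarrow> x \<ominus> y \<in> N"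
proof
  assume "N +> x = N +> y"
  then have "x \<in> N +> y" using a_rcos_self[OF assms(1)] by simp
  then obtain h where "h \<in> N" "x = h \<oplus> y" by (auto simp: a_r_coset_def')
  then show "x \<ominus> y \<in> N" using assms by (simp add: a_minus_def a_assoc r_neg a_Hcarr)
next
  assume "x \<ominus> y \<in> N"
  from coset_add_left[OF this assms(2)] show "N +> x = N +> y"
    using assms by (simp add: a_minus_def a_assoc l_neg)
qed

lemma coset_eq_zero_iff: "x \<in> carrier M \<Longrightarrow> N +> x = zero Q \<longleftrightarrow> x \<in> N"
  by (simp add: zero_quot coset_eq_iff a_minus_def a_inv_def)

lemma monoid_action_quot: "monoid_action Q"
proof -
  have "abelian_group Q"
  proof (rule abelian_groupI)
    fix x assume "x \<in> carrier Q"
    then obtain a where "x = N +> a" "a \<in> carrier M" by (auto simp: carrier_quot)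
    then show "\<exists>y\<in>carrier Q. y \<oplus>\<^bsub>Q\<^esub> x = \<zero>\<^bsub>Q\<^esub>"
      by (intro bexI[of _ "N +> \<ominus> a"]) (auto simp: carrier_quot add_quot zero_quot l_neg)
  next
    fix x y assume "x \<in> carrier Q" "y \<in> carrier Q"
    then obtain a b where ab: "x = N +> a" "y = N +> b" "a \<in> carrier M" "b \<in> carrier M"
      by (auto simp: carrier_quot)
    then show "x \<oplus>\<^bsub>Q\<^esub> y \<in> carrier Q" "x \<oplus>\<^bsub>Q\<^esub> y = y \<oplus>\<^bsub>Q\<^esub> x"
      by (auto simp: carrier_quot add_quot a_comm)
    show "(x \<oplus>\<^bsub>Q\<^esub> y) \<oplus>\<^bsub>Q\<^esub> z = x \<oplus>\<^bsub>Q\<^esub> (y \<oplus>\<^bsub>Q\<^esub> z)" if "z \<in> carrier Q" for z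
      using that ab by (auto simp: carrier_quot add_quot a_assoc)
  qed (auto simp: carrier_quot add_quot zero_quot)
  moreover have "monoid_action_axioms Q"
    by unfold_locales
      (auto simp: carrier_quot add_quot smult_quot smult_add mult_smult one_smult)
  ultimately show ?thesis by (rule monoid_action.intro)
qed

lemma left_module_quot:
  assumes "\<And>r s x. x \<in> carrier M \<Longrightarrow> (r + s) \<odot> x \<ominus> (r \<odot> x \<oplus> s \<odot> x) \<in> N"
  shows "left_module Q"
proof -
  have "N +> (r + s) \<odot> x = N +> (r \<odot> x \<oplus> s \<odot> x)" if "x \<in> carrier M" for r s x
    using that assms[OF that] by (intro coset_eq_iff[THEN iffD2]) auto
  then show ?thesis
    by (intro left_module.intro monoid_action_quot left_module_axioms.intro)
      (auto simp: carrier_quot smult_quot add_quot)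
qed

end

lemma lie_module_uea_module:
  fixes M :: "('g::complex_lie_algebra uea, 'v) module"
  assumes "left_module M"
  shows "lie_module (uea_module_to_lie M)"
proof -
  interpret left_module M by (rule assms)
  let ?V = "uea_module_to_lie M"
  have V: "abelian_group ?V"
  proof (rule abelian_groupI)
    fix x assume "x \<in> carrier ?V"
    then show "\<exists>y\<in>carrier ?V. y \<oplus>\<^bsub>?V\<^esub> x = \<zero>\<^bsub>?V\<^esub>"
      by (intro bexI[of _ "\<ominus>\<^bsub>M\<^esub> x"]) (auto simp: uea_module_to_lie_def l_neg)
  qed (auto simp: uea_module_to_lie_def a_ac)
  from V have "module (ring_of_type_algebra :: complex ring) ?V"
    by (intro moduleI cring_from_type_algebra)
      (simp_all add: uea_module_to_lie_def ring_of_type_algebra_def uea_const_hom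
        smult_add add_smult mult_smult one_smult)
  moreover have "lie_module_axioms ?V"
  proof
    fix x y :: 'g and v assume v: "v \<in> carrier ?V"
    have "\<ominus>\<^bsub>?V\<^esub> b = \<ominus>\<^bsub>M\<^esub> b" if "b \<in> carrier M" for b
      by (rule abelian_group.minus_equality[OF V]) (use that in \<open>simp_all add: uea_module_to_lie_def l_neg\<close>)
    then have minus: "a \<ominus>\<^bsub>?V\<^esub> b = a \<ominus>\<^bsub>M\<^esub> b" if "b \<in> carrier M" for a b
      using that by (simp add: a_minus_def) (simp add: uea_module_to_lie_def)
    show "act ?V (lie x y) v = act ?V x (act ?V y v) \<ominus>\<^bsub>?V\<^esub> act ?V y (act ?V x v)"
      using v minus[of "uea_gen y \<odot>\<^bsub>M\<^esub> (uea_gen x \<odot>\<^bsub>M\<^esub> v)"]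
      by (simp add: uea_module_to_lie_def uea_gen_hom diff_smult mult_smult)
  next
    fix x :: 'g and v c assume v: "v \<in> carrier ?V"
    show "act ?V x (c \<odot>\<^bsub>?V\<^esub> v) = c \<odot>\<^bsub>?V\<^esub> act ?V x v"
      using v by (simp add: uea_module_to_lie_def uea_const_central flip: mult_smult)
  qed (simp_all add: uea_module_to_lie_def uea_gen_hom smult_add add_smult mult_smult)
  ultimately show ?thesis by (rule lie_module.intro)
qed

section \<open>The Whittaker modules\<close>

lemma free_left_module_simps:
  "carrier (free_left_module :: ('s::ring_1, _) module) = UNIV" "zero (free_left_module :: ('s::ring_1, _) module) = 0"
  "add (free_left_module :: ('s::ring_1, _) module) = (+)"
  "module.smult (free_left_module :: ('s::ring_1, _) module) s = frag_extend (\<lambda>(a, n). frag_of (s * a, n))"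
  by (simp_all add: free_left_module_def)

lemma frag_add_induct [case_names zero of uminus add]:
  assumes "P 0" "\<And>a. P (frag_of a)" "\<And>x. P x \<Longrightarrow> P (- x)" "\<And>x y. P x \<Longrightarrow> P y \<Longrightarrow> P (x + y)"
  shows "P x"
proof (rule frag_induction[of x UNIV])
  fix a b assume "P a" "P b"
  then have "P (a + - b)" using assms by blast
  then show "P (a - b)" by simp
qed (use assms in auto)

lemma monoid_action_free:
  "monoid_action (free_left_module :: ('s::ring_1, ('s \<times> 'n) \<Rightarrow>\<^sub>0 int) module)"
proof -
  let ?F = "free_left_module :: ('s::ring_1, ('s \<times> 'n) \<Rightarrow>\<^sub>0 int) module"
  have "abelian_group ?F"
    by (rule abelian_groupI) (auto simp: free_left_module_simps algebra_simps intro: exI[of _ "- _"])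
  moreover have "monoid_action_axioms ?F"
  proof
    fix x :: "('s \<times> 'n) \<Rightarrow>\<^sub>0 int" and r s :: 's
    show "(r * s) \<odot>\<^bsub>?F\<^esub> x = r \<odot>\<^bsub>?F\<^esub> (s \<odot>\<^bsub>?F\<^esub> x)"
      by (induction x rule: frag_add_induct)
        (auto simp: free_left_module_simps frag_extend_add frag_extend_minus mult.assoc)
    show "1 \<odot>\<^bsub>?F\<^esub> x = x"
      by (induction x rule: frag_add_induct)
        (auto simp: free_left_module_simps frag_extend_add frag_extend_minus)
  qed (auto simp: free_left_module_simps frag_extend_add)
  ultimately show ?thesis by (rule monoid_action.intro)
qed

lemma tensor_null_diff: "p \<in> tensor_null \<phi> la \<Longrightarrow> q \<in> tensor_null \<phi> la \<Longrightarrow> p - q \<in> tensor_null \<phi> la"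
  using tensor_null.add[of p \<phi> la "- q"] tensor_null.uminus[of q \<phi> la] by simp

abbreviation frag_act :: "'s::ring_1 \<Rightarrow> ('s \<times> 'n \<Rightarrow>\<^sub>0 int) \<Rightarrow> 's \<times> 'n \<Rightarrow>\<^sub>0 int" where
  "frag_act s \<equiv> frag_extend (\<lambda>(a, n). frag_of (s * a, n))"

lemma tensor_null_act: "p \<in> tensor_null \<phi> la \<Longrightarrow> frag_act s p \<in> tensor_null \<phi> la"
proof (induction rule: tensor_null.induct)
  case (left a b n)
  show ?case
    using tensor_null.left[of "s * a" "s * b" n \<phi> la] by (simp add: frag_extend_diff distrib_left)
next
  case (right a m n)
  show ?case
    using tensor_null.right[of "s * a" m n \<phi> la] by (simp add: frag_extend_diff)
next
  case (balanced a r n)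
  show ?case
    using tensor_null.balanced[of "s * a" \<phi> r n la] by (simp add: frag_extend_diff mult.assoc)
qed (simp_all add: tensor_null.intros frag_extend_add frag_extend_minus)

lemma a_inv_free: "a_inv (free_left_module :: ('s::ring_1, ('s \<times> 'n) \<Rightarrow>\<^sub>0 int) module) x = - x"
proof -
  interpret monoid_action "free_left_module :: ('s::ring_1, ('s \<times> 'n) \<Rightarrow>\<^sub>0 int) module"
    by (rule monoid_action_free)
  show ?thesis by (rule minus_equality) (simp_all add: free_left_module_simps)
qed

lemma a_minus_free: "x \<ominus>\<^bsub>free_left_module :: ('s::ring_1, ('s \<times> 'n) \<Rightarrow>\<^sub>0 int) module\<^esub> y = x - y"
  by (simp add: a_minus_def a_inv_free free_left_module_simps)

lemma action_quotient_tensor: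
  fixes \<phi> :: "'r \<Rightarrow> 's::ring_1" and la :: "'r \<Rightarrow> 'n \<Rightarrow> 'n::ab_group_add"
  shows "action_quotient free_left_module (tensor_null \<phi> la)"
proof -
  interpret monoid_action "free_left_module :: ('s::ring_1, ('s \<times> 'n) \<Rightarrow>\<^sub>0 int) module"
    by (rule monoid_action_free)
  show ?thesis
  proof (intro action_quotient.intro monoid_action_free action_quotient_axioms.intro
      additive_subgroup.intro add.subgroupI)
    show "tensor_null \<phi> la \<noteq> {}" using tensor_null.zero by blast
    fix a assume "a \<in> tensor_null \<phi> la"
    then show "\<ominus>\<^bsub>free_left_module :: ('s, ('s \<times> 'n) \<Rightarrow>\<^sub>0 int) module\<^esub> a \<in> tensor_null \<phi> la"
      by (simp add: a_inv_free tensor_null.uminus)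
  qed (auto simp: free_left_module_simps tensor_null_act tensor_null.intros)
qed

lemma left_module_tensor: "left_module (tensor_module \<phi> la)"
proof -
  interpret action_quotient free_left_module "tensor_null \<phi> la" by (rule action_quotient_tensor)
  have "frag_act (r + s) x - (frag_act r x + frag_act s x) \<in> tensor_null \<phi> la" for r s x
  proof (induction x rule: frag_add_induct)
    case (of a)
    show ?case
      using tensor_null.left[of "r * fst a" "s * fst a" "snd a" \<phi> la]
      by (simp add: case_prod_beta distrib_right diff_diff_eq)
  next
    case (uminus x)
    from tensor_null.uminus[OF this] show ?case by (simp add: frag_extend_minus algebra_simps)
  next
    case (add x y)
    from tensor_null.add[OF this] show ?case by (simp add: frag_extend_add algebra_simps)
  qed (simp add: tensor_null.zero)
  then show ?thesis
    unfolding tensor_module_def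
    by (intro left_module_quot) (simp add: a_minus_free free_left_module_simps)
qed

lemma (in left_module) action_quotient_central:
  assumes "\<And>r. m * r = r * m"
  shows "action_quotient M {m \<odot> w | w. w \<in> carrier M}"
proof (intro action_quotient.intro monoid_action_axioms action_quotient_axioms.intro
    additive_subgroup.intro add.subgroupI)
  fix a b assume a: "a \<in> {m \<odot> w | w. w \<in> carrier M}"
  then obtain v where v: "a = m \<odot> v" "v \<in> carrier M" by blast
  have "\<ominus> a = m \<odot> (\<ominus> v)"
    using v by (simp add: smult_inv)
  then show "\<ominus> a \<in> {m \<odot> w | w. w \<in> carrier M}" using v by blast
  assume "b \<in> {m \<odot> w | w. w \<in> carrier M}"
  then obtain w where "b = m \<odot> w" "w \<in> carrier M" by blast
  then have "a \<oplus> b = m \<odot> (v \<oplus> w)" "v \<oplus> w \<in> carrier M" using v by (simp_all add: smult_add)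
  then show "a \<oplus> b \<in> {m \<odot> w | w. w \<in> carrier M}" by blast
next
  fix x r assume "x \<in> {m \<odot> w | w. w \<in> carrier M}"
  then obtain w where w: "x = m \<odot> w" "w \<in> carrier M" by blast
  then have "r \<odot> x = m \<odot> (r \<odot> w)" using assms by (simp flip: mult_smult)
  then show "r \<odot> x \<in> {m \<odot> w | w. w \<in> carrier M}" using w by auto
qed auto

lemma (in left_module) left_module_quotient:
  assumes "action_quotient M N"
  shows "left_module (quot_module M N)"
proof -
  interpret action_quotient M N by (rule assms)
  have "(r + s) \<odot> x \<ominus> (r \<odot> x \<oplus> s \<odot> x) = \<zero>" if "x \<in> carrier M" for r s x
    using that by (simp add: add_smult a_minus_def r_neg)
  then show ?thesis by (intro left_module_quot) simp
qed

lemma gen_M0_central: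
  "(gen_base (M_basis 0) - uea_const \<xi>) * u = u * (gen_base (M_basis 0) - uea_const \<xi>)"
  (is "?m * _ = _")
proof (induction u rule: uea_sv_induct)
  case (gen_base b u)
  have "bracket_coeff (M_basis 0) b = 0" by (cases b) auto
  then have "gen_base (M_basis 0) * gen_base b = gen_base b * gen_base (M_basis 0)"
    using gen_base_commute[of "M_basis 0" b] by (simp add: uea_const_zero)
  then have comm: "?m * gen_base b = gen_base b * ?m"
    by (simp add: left_diff_distrib right_diff_distrib uea_const_central)
  have "?m * (gen_base b * u) = ?m * gen_base b * u" by (rule mult.assoc[symmetric])
  also have "\<dots> = gen_base b * (?m * u)" unfolding comm by (rule mult.assoc)
  also have "\<dots> = gen_base b * u * ?m" unfolding gen_base by (rule mult.assoc[symmetric])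
  finally show ?case .
next
  case (scale c u)
  have "?m * (uea_const c * u) = uea_const c * (?m * u)"
    by (simp add: left_diff_distrib right_diff_distrib uea_const_pull)
  also have "\<dots> = uea_const c * u * ?m" unfolding scale by (rule mult.assoc[symmetric])
  finally show ?case .
qed (simp_all add: distrib_left distrib_right)

context
  fixes \<psi> :: "sv_plus \<Rightarrow> complex" and \<xi> :: complex
  assumes hom: "lie_hom \<psi>"
begin

abbreviation (input) "relations \<equiv> tensor_null sv_plus_uea_incl (one_dim_action \<psi>)"
abbreviation (input) "M0_shifted \<equiv> gen_base (M_basis 0) - uea_const \<xi>"

lemma sv_plus_uea_incl_affine:
  "sv_plus_uea_incl (uea_gen x + uea_const c) = uea_gen (Rep_sv_plus x) + uea_const c"
  "uea_lift (\<lambda>c. c) \<psi> (uea_gen x + uea_const c) = \<psi> x + c"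
proof -
  have abs: "uea_gen x + uea_const c = abs_uea (free_gen x + free_const c)"
    by (simp add: uea_gen.abs_eq uea_const.abs_eq plus_uea.abs_eq)
  show "sv_plus_uea_incl (uea_gen x + uea_const c) = uea_gen (Rep_sv_plus x) + uea_const c"
    unfolding abs sv_plus_uea_incl_abs
    by (simp add: free_lift_add[where s = uea_const, OF uea_const_zero uea_const_hom(1)]
        free_gen_def free_const_def free_lift_single[where s = uea_const, OF uea_const_zero]
        uea_const_hom(3) zero_free_monoid_def)
  show "uea_lift (\<lambda>c. c) \<psi> (uea_gen x + uea_const c) = \<psi> x + c"
    unfolding abs uea_lift_lie_hom_abs[OF hom]
    by (simp add: free_lift_add free_gen_def free_const_def free_lift_single zero_free_monoid_def)
qed

lemma one_dim_action_const: "one_dim_action \<psi> (uea_const c) n = c * n"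
proof -
  have "uea_lift (\<lambda>c. c) \<psi> (uea_const c) = c"
    unfolding uea_const.abs_eq uea_lift_lie_hom_abs[OF hom]
    by (simp add: free_const_def free_lift_single zero_free_monoid_def)
  then show ?thesis by (simp add: one_dim_action_def)
qed

lemma relations_zero: "frag_of (0, n) \<in> relations" "frag_of (a, 0) \<in> relations"
proof -
  show "frag_of (0, n) \<in> relations"
    using tensor_null.uminus[OF tensor_null.left[of 0 0 n sv_plus_uea_incl "one_dim_action \<psi>"]] by simp
  show "frag_of (a, 0) \<in> relations"
    using tensor_null.uminus[OF tensor_null.right[of a 0 0 sv_plus_uea_incl "one_dim_action \<psi>"]] by simp
qed

lemma whittaker_relation:
  "frag_of (uea_gen (Rep_sv_plus x) - uea_const (\<psi> x), 1) \<in> relations"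
proof -
  let ?r = "uea_gen x + uea_const (- \<psi> x)"
  have "uea_const (- \<psi> x) = - (uea_const (\<psi> x) :: sv uea)"
    using uea_const_hom(1)[of "- \<psi> x" "\<psi> x"] by (simp add: uea_const_zero eq_neg_iff_add_eq_0)
  then have "frag_of (uea_gen (Rep_sv_plus x) - uea_const (\<psi> x), 1) - frag_of (1, 0) \<in> relations"
    using tensor_null.balanced[of 1 sv_plus_uea_incl ?r 1 "one_dim_action \<psi>"]
    by (simp add: sv_plus_uea_incl_affine one_dim_action_def)
  from tensor_null.add[OF this relations_zero(2)[of 1]] show ?thesis by simp
qed

text \<open>Scalars are moved from the second tensor factor to the first, so every tensor is of the form
  \<open>u \<otimes> 1\<close>.\<close>

lemma relations_cyclic: "\<exists>u. f - frag_of (u, 1) \<in> relations"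
proof (induction f rule: frag_add_induct)
  case zero
  show ?case using tensor_null.uminus[OF relations_zero(1)[of 1]] by auto
next
  case (of p)
  obtain a n where p: "p = (a, n)" by fastforce
  have "frag_of (a * sv_plus_uea_incl (uea_const n), 1) - frag_of (a, n) \<in> relations"
    using tensor_null.balanced[of a sv_plus_uea_incl "uea_const n" 1 "one_dim_action \<psi>"]
    by (simp add: one_dim_action_const)
  from tensor_null.uminus[OF this] show ?case unfolding p by auto
next
  case (uminus f)
  then obtain u where u: "f - frag_of (u, 1) \<in> relations" by blast
  have "frag_of (0, 1) - frag_of (u, 1) - frag_of (- u, 1) \<in> relations"
    using tensor_null.left[of u "- u" 1 sv_plus_uea_incl "one_dim_action \<psi>"] by simp
  from tensor_null_diff[OF this relations_zero(1)[of 1]]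
  have "- frag_of (u, 1) - frag_of (- u, 1) \<in> relations" by simp
  from tensor_null_diff[OF this u] have "- frag_of (u, 1) - frag_of (- u, 1) - (f - frag_of (u, 1)) \<in> relations" .
  moreover have "- frag_of (u, 1) - frag_of (- u, 1) - (f - frag_of (u, 1)) = - f - frag_of (- u, 1)"
    by (simp add: algebra_simps)
  ultimately show ?case by metis
next
  case (add f g)
  then obtain u v where "f - frag_of (u, 1) \<in> relations" "g - frag_of (v, 1) \<in> relations" by blast
  from tensor_null_diff[OF tensor_null.add[OF this] tensor_null.left[of u v 1 sv_plus_uea_incl "one_dim_action \<psi>"]]
  have "f + g - frag_of (u + v, 1) \<in> relations" by (simp add: algebra_simps)
  then show ?case by blast
qed

lemma action_functional_sv_plus:
  fixes \<omega> :: "sv uea \<Rightarrow> complex"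
  assumes \<omega>: "\<And>u v. \<omega> (u + v) = \<omega> u + \<omega> v" "\<And>c u. \<omega> (uea_const c * u) = c * \<omega> u"
    "\<And>u b. 0 \<le> basis_rank b \<Longrightarrow> \<omega> (u * gen_base b) = extended_character \<psi> \<xi> b * \<omega> u"
  shows "\<omega> (u * uea_gen (Rep_sv_plus x)) = \<psi> x * \<omega> u"
proof -
  have zero: "\<omega> 0 = 0" using \<omega>(1)[of 0 0] by simp
  have base: "\<omega> (u * uea_gen y) = \<psi> (Abs_sv_plus y) * \<omega> u" if y: "y \<in> sv_plus_basis" for y
  proof -
    have "\<exists>b. y = sv_base b \<and> 0 \<le> basis_rank b \<and> b \<noteq> M_basis 0"
    proof -
      from y consider n where "y = sv_base (L_basis n)" "1 \<le> n" | n where "y = sv_base (M_basis n)" "1 \<le> n"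
        | n where "y = sv_base (Y_basis n)" "0 \<le> n"
        by (auto simp: sv_plus_basis_def sv_base_simps)
      then show ?thesis by cases (rule exI, rule conjI, assumption, simp)+
    qed
    then show ?thesis using \<omega>(3) by (auto simp: extended_character_def)
  qed
  have "\<omega> (u * uea_gen y) = \<psi> (Abs_sv_plus y) * \<omega> u" if "y \<in> complex_vs.span sv_plus_basis" for y
  proof -
    have "y \<in> complex_vs.span sv_plus_basis \<and> \<omega> (u * uea_gen y) = \<psi> (Abs_sv_plus y) * \<omega> u"
      using that
    proof (induction rule: complex_vs.span_induct_alt)
      case base
      have "uea_gen (0 :: sv) = 0" using uea_gen_hom(1)[of "0 :: sv" 0] by simp
      moreover have "\<psi> 0 = 0" using hom unfolding lie_hom_def by (metis add_cancel_right_right)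
      ultimately show ?case
        by (simp add: zero complex_vs.span_zero flip: zero_sv_plus_def)
    next
      case (step c x y)
      let ?x = "Abs_sv_plus x" and ?y = "Abs_sv_plus y"
      have mem: "x \<in> complex_vs.span sv_plus_basis" "y \<in> complex_vs.span sv_plus_basis"
        using step complex_vs.span_base by auto
      have "Abs_sv_plus (c *\<^sub>C x + y) = c *\<^sub>C ?x + ?y"
        by (rule Rep_sv_plus_inject[THEN iffD1])
          (simp add: plus_sv_plus.rep_eq scaleC_sv_plus.rep_eq Abs_sv_plus_inverse mem
            complex_vs.span_add complex_vs.span_scale)
      then have "\<psi> (Abs_sv_plus (c *\<^sub>C x + y)) = c * \<psi> ?x + \<psi> ?y"
        using hom unfolding lie_hom_def by (simp add: scaleC_complex_def)
      moreover have "\<omega> (u * uea_gen (c *\<^sub>C x + y)) = c * \<omega> (u * uea_gen x) + \<omega> (u * uea_gen y)"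
        by (simp add: uea_gen_hom distrib_left \<omega>(1)) (metis \<omega>(2) mult.assoc uea_const_central)
      ultimately show ?case
        using mem step base by (simp add: complex_vs.span_add complex_vs.span_scale algebra_simps)
    qed
    then show ?thesis by blast
  qed
  from this[OF Rep_sv_plus[of x]] show ?thesis by (simp add: Rep_sv_plus_inverse)
qed

text \<open>From generators to all of \<open>U(sv\<^sup>+)\<close>, as needed for the balancing relations of the tensor product.\<close>

lemma functional_incl:
  fixes \<omega> :: "sv uea \<Rightarrow> complex"
  assumes \<omega>: "\<And>u v. \<omega> (u + v) = \<omega> u + \<omega> v" "\<And>c u. \<omega> (uea_const c * u) = c * \<omega> u"
    "\<And>u x. \<omega> (u * uea_gen (Rep_sv_plus x)) = \<psi> x * \<omega> u"
  shows "\<omega> (u * sv_plus_uea_incl r) = \<omega> u * uea_lift (\<lambda>c. c) \<psi> r"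
proof -
  have zero: "\<omega> 0 = 0" using \<omega>(1)[of 0 0] by simp
  have word: "\<omega> (u * prod_list (map (\<lambda>x. uea_gen (Rep_sv_plus x)) l)) = \<omega> u * prod_list (map \<psi> l)" for u l
  proof (induction l arbitrary: u)
    case (Cons x l)
    then show ?case by (simp add: \<omega>(3) flip: mult.assoc)
  qed simp
  have "\<omega> (u * sv_plus_uea_incl (abs_uea p)) = \<omega> u * uea_lift (\<lambda>c. c) \<psi> (abs_uea p)" for p
    unfolding sv_plus_uea_incl_abs uea_lift_lie_hom_abs[OF hom]
  proof (induction p rule: pm_induct)
    case zero
    show ?case by (simp add: free_lift_def \<open>\<omega> 0 = 0\<close>)
  next
    case (single w c)
    have "\<omega> (u * (uea_const c * v)) = c * \<omega> (u * v)" for v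
      by (metis \<omega>(2) mult.assoc uea_const_central)
    then show ?case
      by (simp add: free_lift_single[where s = uea_const, OF uea_const_zero] free_lift_single word)
  next
    case (add p q)
    then show ?case
      by (simp add: free_lift_add[where s = uea_const, OF uea_const_zero uea_const_hom(1)]
          free_lift_add distrib_left \<omega>(1))
  qed
  then show ?thesis by (metis Quotient3_abs_rep[OF Quotient3_uea])
qed

text \<open>In other words \<open>1 \<otimes> 1\<close> is not a multiple of \<open>M\<^sub>0 - \<xi>\<close>: the map
  \<open>a \<otimes> n \<mapsto> \<omega>(a) n\<close> kills the tensor relations and, as \<open>M\<^sub>0\<close> is central with \<open>\<omega>(a M\<^sub>0) = \<xi> \<omega>(a)\<close>, also
  those multiples, but it sends \<open>1 \<otimes> 1\<close> to 1.\<close>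

lemma relations_proper: "frag_of (1, 1) - frag_act M0_shifted f \<notin> relations"
proof
  assume rel: "frag_of (1, 1) - frag_act M0_shifted f \<in> relations"
  obtain \<omega> :: "sv uea \<Rightarrow> complex" where \<omega>:
    "\<And>u v. \<omega> (u + v) = \<omega> u + \<omega> v" "\<And>c u. \<omega> (uea_const c * u) = c * \<omega> u" "\<omega> 1 = 1"
    "\<And>u b. 0 \<le> basis_rank b \<Longrightarrow> \<omega> (u * gen_base b) = extended_character \<psi> \<xi> b * \<omega> u"
    using uea_functional_exists[OF hom, of \<xi>] by metis
  have incl: "\<omega> (u * sv_plus_uea_incl r) = \<omega> u * uea_lift (\<lambda>c. c) \<psi> r" for u r
    by (intro functional_incl \<omega> action_functional_sv_plus)
  define \<Phi> :: "(sv uea \<times> complex \<Rightarrow>\<^sub>0 int) \<Rightarrow> complex" where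
    "\<Phi> f = (\<Sum>k\<in>Poly_Mapping.keys f. of_int (Poly_Mapping.lookup f k) * (\<omega> (fst k) * snd k))" for f
  have sup: "\<Phi> f = (\<Sum>k\<in>A. of_int (Poly_Mapping.lookup f k) * (\<omega> (fst k) * snd k))"
    if "finite A" "Poly_Mapping.keys f \<subseteq> A" for f A
    unfolding \<Phi>_def by (rule sum.mono_neutral_left) (use that in \<open>auto simp: in_keys_iff\<close>)
  have add: "\<Phi> (f + g) = \<Phi> f + \<Phi> g" for f g
  proof -
    let ?A = "Poly_Mapping.keys f \<union> Poly_Mapping.keys g"
    have "Poly_Mapping.keys (f + g) \<subseteq> ?A" by (rule keys_add)
    then show ?thesis by (simp add: sup[of ?A] lookup_add distrib_right sum.distrib)
  qed
  have zero: "\<Phi> 0 = 0" by (simp add: \<Phi>_def)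
  have minus: "\<Phi> (- f) = - \<Phi> f" for f
    using add[of "- f" f] zero by (simp add: eq_neg_iff_add_eq_0)
  have diff: "\<Phi> (f - g) = \<Phi> f - \<Phi> g" for f g
    using add[of f "- g"] minus[of g] by simp
  have of: "\<Phi> (frag_of (a, n)) = \<omega> a * n" for a n by (simp add: \<Phi>_def)
  have kill: "\<Phi> g = 0" if "g \<in> relations" for g
    using that
    by (induction rule: tensor_null.induct)
      (simp_all add: zero add minus diff of \<omega>(1) algebra_simps incl one_dim_action_def)
  have "\<Phi> (frag_act M0_shifted f) = 0"
  proof (induction f rule: frag_add_induct)
    case (of p)
    obtain a n where p: "p = (a, n)" by fastforce
    have "M0_shifted * a = a * gen_base (M_basis 0) - uea_const \<xi> * a"
      by (simp add: gen_M0_central right_diff_distrib uea_const_central)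
    then have "\<omega> (M0_shifted * a) = 0"
      using \<omega>(4)[of "M_basis 0" a] \<omega>(1)[of "M0_shifted * a" "uea_const \<xi> * a"]
      by (simp add: \<omega>(2) extended_character_def)
    then show ?case by (simp add: p \<open>\<And>n a. \<Phi> (frag_of (a, n)) = \<omega> a * n\<close>)
  qed (simp_all add: zero add minus frag_extend_add frag_extend_minus)
  then show False using kill[OF rel] by (simp add: diff of \<omega>(3))
qed

abbreviation (input) "W \<equiv> whittaker_W \<psi>"
abbreviation (input) "L \<equiv> whittaker_L \<psi> \<xi>"
abbreviation (input) "M0_multiples \<equiv> {M0_shifted \<odot>\<^bsub>W\<^esub> w | w. w \<in> carrier W}"

lemma whittaker_W_left_module: "left_module W"
  unfolding whittaker_W_def by (rule left_module_tensor)

lemma whittaker_W_quotient: "action_quotient W M0_multiples"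
  by (rule left_module.action_quotient_central[OF whittaker_W_left_module gen_M0_central])

lemma whittaker_L_quot: "L = quot_module W M0_multiples"
  by (simp only: whittaker_L_def sv_base_simps)

lemma whittaker_L_left_module: "left_module L"
  unfolding whittaker_L_quot
  by (rule left_module.left_module_quotient[OF whittaker_W_left_module whittaker_W_quotient])

lemma whittaker_L_cyclic:
  obtains v where "v \<in> carrier L" "carrier L = {u \<odot>\<^bsub>L\<^esub> v | u. True}" "v \<noteq> zero L"
    "\<And>z. 0 \<le> basis_rank z \<Longrightarrow>
       (gen_base z - uea_const (extended_character \<psi> \<xi> z)) \<odot>\<^bsub>L\<^esub> v = zero L"
proof -
  let ?F = "free_left_module :: (sv uea, (sv uea \<times> complex) \<Rightarrow>\<^sub>0 int) module"
  interpret T: action_quotient ?F relations by (rule action_quotient_tensor)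
  interpret quo: action_quotient W M0_multiples by (rule whittaker_W_quotient)
  have W: "W = T.Q" by (simp add: whittaker_W_def tensor_module_def)
  note L = whittaker_L_quot
  let ?c = "\<lambda>f. relations +>\<^bsub>?F\<^esub> f"
  let ?d = "\<lambda>w. M0_multiples +>\<^bsub>W\<^esub> w"
  have carW: "carrier W = range ?c"
    unfolding W T.carrier_quot by (auto simp: free_left_module_simps)
  have smW: "r \<odot>\<^bsub>W\<^esub> ?c f = ?c (frag_act r f)" for r f
    unfolding W by (simp add: T.smult_quot free_left_module_simps)
  have eqW: "?c f = ?c g \<longleftrightarrow> f - g \<in> relations" for f g
    by (simp add: T.coset_eq_iff a_minus_free free_left_module_simps)
  define w where "w = ?c (frag_of (1, 1))"
  have w: "w \<in> carrier W" by (simp add: w_def carW)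
  have uw: "u \<odot>\<^bsub>W\<^esub> w = ?c (frag_of (u, 1))" for u
    by (simp add: w_def smW)
  have smL: "u \<odot>\<^bsub>L\<^esub> ?d y = ?d (u \<odot>\<^bsub>W\<^esub> y)" if "y \<in> carrier W" for u y
    unfolding L using that by (rule quo.smult_quot)
  have zeroL: "?d y = zero L \<longleftrightarrow> y \<in> M0_multiples" if "y \<in> carrier W" for y
    unfolding L using that by (rule quo.coset_eq_zero_iff)
  show thesis
  proof (rule that[of "?d w"])
    show dw: "?d w \<in> carrier L" unfolding L quo.carrier_quot using w by blast
    show "carrier L = {u \<odot>\<^bsub>L\<^esub> ?d w | u. True}"
    proof (intro equalityI subsetI)
      fix x assume "x \<in> carrier L"
      then obtain y where "x = ?d y" "y \<in> carrier W" unfolding L quo.carrier_quot by blast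
      then obtain f where x: "x = ?d (?c f)" unfolding carW by blast
      obtain u where "f - frag_of (u, 1) \<in> relations" using relations_cyclic by blast
      then have "?c f = u \<odot>\<^bsub>W\<^esub> w" by (simp only: uw eqW)
      then have "x = u \<odot>\<^bsub>L\<^esub> ?d w" unfolding x smL[OF w] by (rule arg_cong)
      then show "x \<in> {u \<odot>\<^bsub>L\<^esub> ?d w | u. True}" by blast
    next
      fix x assume "x \<in> {u \<odot>\<^bsub>L\<^esub> ?d w | u. True}"
      then show "x \<in> carrier L"
        using dw monoid_action.smult_closed[OF quo.monoid_action_quot] unfolding L by blast
    qed
    show "?d w \<noteq> zero L"
    proof
      assume "?d w = zero L"
      then obtain y where y: "w = M0_shifted \<odot>\<^bsub>W\<^esub> y" "y \<in> carrier W"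
        using zeroL[OF w] by blast
      then obtain f where "y = ?c f" by (auto simp: carW)
      then have "frag_of (1, 1) - frag_act M0_shifted f \<in> relations"
        using y(1) by (simp only: smW w_def eqW)
      then show False using relations_proper by blast
    qed
    fix z assume z: "0 \<le> basis_rank z"
    let ?r = "gen_base z - uea_const (extended_character \<psi> \<xi> z)"
    have rw: "?r \<odot>\<^bsub>W\<^esub> w \<in> carrier W" by (simp add: uw carW)
    have "?r \<odot>\<^bsub>W\<^esub> w \<in> M0_multiples"
    proof (cases "z = M_basis 0")
      case True
      then have r: "?r = M0_shifted" by (simp add: extended_character_def)
      show ?thesis unfolding r using w by blast
    next
      case False
      define x where "x = Abs_sv_plus (sv_base z)"
      have x: "Rep_sv_plus x = sv_base z"
        unfolding x_def by (rule Abs_sv_plus_inverse[OF sv_base_in_sv_plus[OF z False]])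
      have "frag_of (?r, 1) \<in> relations"
        using whittaker_relation[of x] False by (simp add: x extended_character_def x_def[symmetric])
      then have "?r \<odot>\<^bsub>W\<^esub> w = ?c 0" by (simp only: uw eqW diff_zero)
      also have "\<dots> = zero W"
        unfolding W T.zero_quot by (simp add: free_left_module_simps)
      finally show ?thesis using quo.zero_closed by (simp only:)
    qed
    then show "?r \<odot>\<^bsub>L\<^esub> ?d w = zero L" unfolding smL[OF w] using zeroL[OF rw] by (rule iffD2[rotated])
  qed
qed

end

text \<open>A Lie submodule is stable under \<open>U\<close>, which is generated by \<open>sv\<close> and the scalars.\<close>

lemma lie_submodule_smult:
  fixes u :: "sv uea"
  assumes M: "left_module M" and N: "lie_submodule N (uea_module_to_lie M)" and v: "v \<in> N"
  shows "u \<odot>\<^bsub>M\<^esub> v \<in> N"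
proof -
  interpret left_module M by (rule M)
  let ?V = "uea_module_to_lie M"
  interpret lie_module ?V by (rule lie_module_uea_module[OF M])
  have sub: "submodule N ring_of_type_algebra ?V" and act: "\<And>x y. y \<in> N \<Longrightarrow> act ?V x y \<in> N"
    using N by (auto simp: lie_submodule_def)
  note E = submoduleE[OF sub]
  have carr: "y \<in> carrier M" if "y \<in> N" for y
    using E(1) that by (auto simp: uea_module_to_lie_def)
  have add: "x \<oplus>\<^bsub>M\<^esub> y \<in> N" if "x \<in> N" "y \<in> N" for x y
    using E(5)[OF that] by (simp add: uea_module_to_lie_def)
  have const: "uea_const c \<odot>\<^bsub>M\<^esub> y \<in> N" if "y \<in> N" for c y
    using E(4)[OF _ that, of c] by (simp add: uea_module_to_lie_def ring_of_type_algebra_def)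
  have gen: "uea_gen x \<odot>\<^bsub>M\<^esub> y \<in> N" if "y \<in> N" for x y
    using act[OF that, of x] by (simp add: uea_module_to_lie_def)
  show ?thesis
  proof (induction u rule: uea_sv_induct)
    case zero
    show ?case using const[OF v, of 0] by (simp add: uea_const_zero)
  qed (use v carr[OF v] in \<open>simp_all add: one_smult mult_smult add_smult gen const add\<close>)
qed

section \<open>Irreducibility\<close>

theorem proposition4p5:
  fixes \<psi> :: "sv_plus \<Rightarrow> complex" and \<xi> :: complex
  assumes "lie_hom \<psi>" and "\<psi> sv_plus_M1 \<noteq> 0"
  shows "irreducible_lie_module (uea_module_to_lie (whittaker_L \<psi> \<xi>))"
proof -
  let ?L = "whittaker_L \<psi> \<xi>"
  interpret L: left_module ?L by (rule whittaker_L_left_module[OF assms(1)])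
  obtain v where v: "v \<in> carrier ?L" "carrier ?L = {u \<odot>\<^bsub>?L\<^esub> v | u. True}" "v \<noteq> zero ?L"
    and whittaker: "\<And>z. 0 \<le> basis_rank z \<Longrightarrow>
       (gen_base z - uea_const (extended_character \<psi> \<xi> z)) \<odot>\<^bsub>?L\<^esub> v = zero ?L"
    by (rule whittaker_L_cyclic[OF assms(1), of \<xi>]) (rule that)
  define I where "I = {u. u \<odot>\<^bsub>?L\<^esub> v = zero ?L}"
  have "Abs_sv_plus (sv_base (M_basis 1)) = sv_plus_M1"
    by (simp add: sv_base_simps sv_plus_M1_def)
  then have M1: "extended_character \<psi> \<xi> (M_basis 1) \<noteq> 0"
    using assms(2) by (simp add: extended_character_def)
  interpret I: whittaker_left_ideal \<psi> \<xi> I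
    by unfold_locales
      (use assms(1) M1 v(1) whittaker in
        \<open>simp_all add: I_def L.zero_smult L.add_smult L.mult_smult L.smult_zero\<close>)
  have "N = {zero ?L} \<or> N = carrier ?L" if N: "lie_submodule N (uea_module_to_lie ?L)" for N
  proof -
    interpret V: lie_module "uea_module_to_lie ?L"
      by (rule lie_module_uea_module[OF L.left_module_axioms])
    have "submodule N ring_of_type_algebra (uea_module_to_lie ?L)"
      using N by (simp add: lie_submodule_def)
    note E = V.submoduleE[OF this]
    have subset: "N \<subseteq> carrier ?L" using E(1) by (simp add: uea_module_to_lie_def)
    have add: "x \<oplus>\<^bsub>?L\<^esub> y \<in> N" if "x \<in> N" "y \<in> N" for x y
      using E(5)[OF that] by (simp add: uea_module_to_lie_def)
    note smult = lie_submodule_smult[OF L.left_module_axioms N]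
    obtain y where y: "y \<in> N" using E(2) by blast
    have zero: "zero ?L \<in> N"
      using smult[OF y, of 0] L.zero_smult[of y] y subset by auto
    define J where "J = {u. u \<odot>\<^bsub>?L\<^esub> v \<in> N}"
    show ?thesis
    proof (cases "1 \<in> J")
      case True
      then have "v \<in> N" using v(1) by (simp add: J_def L.one_smult)
      then have "carrier ?L \<subseteq> N" unfolding v(2) using smult by blast
      then show ?thesis using subset by blast
    next
      case False
      have "J = I"
        by (rule I.maximal)
          (use False v(1) zero in \<open>auto simp: J_def I_def L.add_smult L.mult_smult add smult\<close>)
      have "x = zero ?L" if "x \<in> N" for x
      proof -
        have "x \<in> carrier ?L" using that subset by blast
        then obtain u where u: "x = u \<odot>\<^bsub>?L\<^esub> v" unfolding v(2) by blast
        then have "u \<in> J" using that by (simp add: J_def)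
        then show ?thesis using \<open>J = I\<close> u by (simp add: I_def)
      qed
      then show ?thesis using zero by blast
    qed
  qed
  moreover have "carrier ?L \<noteq> {zero ?L}" using v(1,3) by blast
  ultimately show ?thesis
    unfolding irreducible_lie_module_def
    using lie_module_uea_module[OF L.left_module_axioms]
    by (simp add: uea_module_to_lie_def)
qed

end
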